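(* Let $\alpha_k$ be a simple root and let $C_k$ be the operator on $\bigoplus_{\sigma\in W}\mathrm{Frac}\big(R(T\times T^*\times\mathbb C^* )\big)[[q]]$ given by $$C_k(\{f_\bullet\})_\sigma(\lambda)=\delta\big(L_{k,\sigma},h^{\langle\lambda,\alpha_k^\vee\rangle}\big)\,f_\sigma(s_k\lambda)+\delta(L_{k,\sigma},h)\,f_{\sigma s_k}(s_k\lambda).$$ Then the square of $C_k$ is multiplication by a function depending only on $\lambda$ and $h$: $$C_k\circ C_k=\kappa_k(\lambda)\,\mathrm{id},\qquad \kappa_k(\lambda)=\delta(h,\nu_k(\lambda))\,\delta(h,1/\nu_k(\lambda)),\qquad \nu_k(\lambda)=h^{\langle\lambda,\alpha_k^\vee\rangle}.$$
   Context: $\vartheta(x)=x^{1/2}(1-x^{-1})\prod_{n\ge1}(1-q^nx)(1-q^n/x)$, $\vartheta'(1)$ is its derivative at $x=1$, and $\delta(a,b)=\frac{\vartheta(ab)\vartheta'(1)}{\vartheta(a)\vartheta(b)}$, a power series in $q$ whose coefficients are rational functions of $a,b$. $G$ is a complex reductive group (simply connected semisimple, or $GL_n$) with maximal torus $T$ (with Lie algebra $\mathfrak t$), Weyl group $W$, simple roots $\alpha_k$, coroots $\alpha_k^\vee$, simple reflections $s_k$. Elements of $\mathrm{Frac}(R(T\times T^*\times\mathbb C^* ))$ are viewed as functions of $T$, of $\lambda\in\mathfrak t^*$ through the functions $\lambda\mapsto h^{\langle\lambda,\beta^\vee\rangle}$ ($\beta^\vee$ coroots, regarded as characters of the dual torus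 $T^*$), and of the coordinate $h$ of $\mathbb C^*$. $L_{k,\sigma}=e^{-\sigma\alpha_k}\in R(T)$ is the character of the $T$-equivariant line bundle $L_k=G\times_B\mathbb C_{-\alpha_k}$ at the fixed point $x_\sigma=\sigma B\in G/B$. *)

theory Defs
  imports
    "HOL-Analysis.Infinite_Products"
    "HOL-Computational_Algebra.Computational_Algebra"
    "HOL-Library.Poly_Mapping"
    "HOL-Library.FuncSet"
begin

instance fract :: ("{idom, ring_char_0}") ring_char_0
proof
  show "inj (of_nat :: nat \<Rightarrow> 'a fract)"
    by (rule injI) (simp add: of_nat_fract eq_fract)
qed

instance fract :: ("{idom, ring_char_0}") field_char_0 ..


subsection \<open>The theta function and the function \<open>\<delta>\<close>\<close>

lemma theta_product_converges:
  fixes x :: "'a::{comm_ring_1,inverse}"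
  shows "convergent_prod (\<lambda>n. (1 - fps_X ^ Suc n * fps_const x) *
           (1 - fps_X ^ Suc n * fps_const (inverse x)))"
proof -
  define f where "f = (\<lambda>n. (1 - fps_X ^ Suc n * fps_const x) *
    (1 - fps_X ^ Suc n * fps_const (inverse x)))"
  define P where "P = (\<lambda>N. \<Prod>n\<le>N. f n)"
  have ring: "(1 - y * c) * (1 - y * d) = 1 - y * (c + d - c * (y * d))"
    for y c d :: "'a fps" by (simp add: algebra_simps)
  have step: "fps_nth (P (Suc N)) m = fps_nth (P N) m" if "m \<le> N" for m N
  proof -
    obtain g where "f (Suc N) = 1 - fps_X ^ Suc (Suc N) * g"
      unfolding f_def ring by blast
    then have "P (Suc N) = P N - fps_X ^ Suc (Suc N) * (P N * g)"
      by (simp only: P_def prod.atMost_Suc)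
        (simp add: right_diff_distrib mult.left_commute del: power_Suc)
    then show ?thesis
      using that by (simp add: fps_X_power_mult_nth del: power_Suc)
  qed
  have stable: "fps_nth (P N) m = fps_nth (P m) m" if "m \<le> N" for m N
    using that by (induction N rule: dec_induct) (simp_all add: step)
  have 0: "fps_nth (P N) 0 = 1" for N
    using stable[of 0 N] by (simp add: P_def f_def)
  define L where "L = Abs_fps (\<lambda>m. fps_nth (P m) m)"
  have "P \<longlonglongrightarrow> L"
    by (rule tendsto_fpsI) (auto simp: eventually_sequentially L_def intro: stable)
  moreover have "fps_nth L 0 = 1" by (simp add: L_def 0)
  then have "L \<noteq> 0" by auto
  ultimately have "raw_has_prod f 0 L"
    by (simp add: raw_has_prod_def P_def)
  then show ?thesis unfolding f_def convergent_prod_def by blast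
qed

text \<open>
  Power series in \<open>q\<close> are elements of \<^typ>\<open>'a fps\<close>, infinite products are taken in the
  \<open>q\<close>-adic topology. \<open>theta_red x\<close> is \<open>\<vartheta>(x)\<close> without the factor \<open>x\<^sup>1\<^sup>/\<^sup>2\<close>.
  The coefficient class is not restricted to fields because \<open>\<vartheta>\<close> is also
  evaluated at \<open>x = 1 + \<epsilon>\<close> in \<open>\<K>[[\<epsilon>]]\<close> in order to differentiate it.
\<close>

definition theta_red :: "'a::{comm_ring_1,inverse} \<Rightarrow> 'a fps" where
  "theta_red x = fps_const (1 - inverse x) *
     prodinf (\<lambda>n. (1 - fps_X ^ Suc n * fps_const x) *
       (1 - fps_X ^ Suc n * fps_const (inverse x)))"

text \<open>
  \<open>\<vartheta>(x)\<close> is two-valued in \<open>x\<close>; the argument of \<open>theta\<close> is the chosen root \<open>r = x\<^sup>1\<^sup>/\<^sup>2\<close>.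
\<close>

definition theta :: "'a::{comm_ring_1,inverse} \<Rightarrow> 'a fps" where
  "theta r = fps_const r * theta_red (r ^ 2)"

text \<open>
  \<open>\<vartheta>'(1)\<close>: each \<open>q\<close>-coefficient of \<open>\<vartheta>(1 + \<epsilon>)\<close>, expanded with the branch
  \<open>(1 + \<epsilon>)\<^sup>1\<^sup>/\<^sup>2 = 1 + \<epsilon>/2 + \<dots>\<close>, is differentiated with respect to \<open>\<epsilon>\<close> at \<open>\<epsilon> = 0\<close>.
\<close>

definition theta_deriv_1 :: "'a::field_char_0 fps" where
  "theta_deriv_1 =
     Abs_fps (\<lambda>n. fps_nth (fps_deriv (fps_nth (theta (fps_binomial (1/2) :: 'a fps)) n)) 0)"

lemma fps_binomial_half_square:
  "(fps_binomial (1/2) :: 'a::field_char_0 fps) ^ 2 = 1 + fps_X"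
  by (simp add: power2_eq_square flip: fps_binomial_add_mult) (simp add: fps_binomial_1)

text \<open>
  In \<open>\<vartheta>(ab)\<vartheta>'(1) / (\<vartheta>(a)\<vartheta>(b))\<close> the half-integral powers cancel, as
  \<open>(ab)\<^sup>1\<^sup>/\<^sup>2 = a\<^sup>1\<^sup>/\<^sup>2 b\<^sup>1\<^sup>/\<^sup>2\<close>; so \<open>\<delta>(a,b)\<close> makes sense in fields where \<open>a\<close> and \<open>b\<close> are not squares.
  Lemma \<open>delta_square\<close> is the formula with the roots left in.
\<close>

definition delta :: "'a::field_char_0 \<Rightarrow> 'a \<Rightarrow> 'a fps" where
  "delta a b = theta_red (a * b) * theta_deriv_1 / (theta_red a * theta_red b)"

lemma delta_square:
  fixes r s :: "'a::field_char_0"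
  assumes "r \<noteq> 0" "s \<noteq> 0"
  shows "delta (r ^ 2) (s ^ 2) = theta (r * s) * theta_deriv_1 / (theta r * theta s)"
proof -
  have "theta (r * s) * theta_deriv_1 =
      fps_const (r * s) * (theta_red (r ^ 2 * s ^ 2) * theta_deriv_1)"
    by (simp add: theta_def power_mult_distrib mult.assoc)
  moreover have "theta r * theta s =
      fps_const (r * s) * (theta_red (r ^ 2) * theta_red (s ^ 2))"
    by (simp add: theta_def mult_ac flip: fps_const_mult)
  moreover have "fps_const (r * s) \<noteq> 0" using assms by simp
  ultimately show ?thesis
    by (simp only: delta_def div_mult_mult1 not_False_eq_True)
qed


subsection \<open>Root data\<close>

text \<open>
  The character lattice of the torus \<open>T\<close> and its cocharacter lattice are identified with
  \<open>\<int>\<^sup>n\<close> by means of a basis of characters indexed by the finite type \<^typ>\<open>'n\<close> and the dual basis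
  of cocharacters. The order on \<^typ>\<open>'n\<close> has no mathematical content: it only provides
  an order on the free abelian groups below, on which the library's proof that their
  group rings are integral domains depends.
\<close>

type_synonym 'n lattice = "'n \<Rightarrow>\<^sub>0 int"

definition pairing :: "'n::finite lattice \<Rightarrow> 'n lattice \<Rightarrow> int" where
  "pairing x y = (\<Sum>i\<in>UNIV. Poly_Mapping.lookup x i * Poly_Mapping.lookup y i)"

definition reflection :: "'n::finite lattice \<Rightarrow> 'n lattice \<Rightarrow> 'n lattice \<Rightarrow> 'n lattice" where
  "reflection \<alpha> \<alpha>v x = x - frag_cmul (pairing x \<alpha>v) \<alpha>"

definition coreflection :: "'n::finite lattice \<Rightarrow> 'n lattice \<Rightarrow> 'n lattice \<Rightarrow> 'n lattice" where
  "coreflection \<alpha> \<alpha>v y = y - frag_cmul (pairing \<alpha> y) \<alpha>v"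

interpretation zmod: module "frag_cmul :: int \<Rightarrow> 'n lattice \<Rightarrow> 'n lattice"
  by unfold_locales (simp_all add: frag_cmul_distrib frag_cmul_distrib2)

text \<open>
  A reduced root datum with a choice of simple roots. Complex reductive groups with a
  maximal torus and a Borel subgroup containing it correspond to such data.
\<close>

locale based_root_datum =
  fixes \<Phi> :: "'n::finite lattice set"
    and coroot :: "'n lattice \<Rightarrow> 'n lattice"
    and \<Delta> :: "'n lattice set"
  assumes finite_roots: "finite \<Phi>"
    and coroot_inj: "inj_on coroot \<Phi>"
    and pairing_coroot: "\<And>\<alpha>. \<alpha> \<in> \<Phi> \<Longrightarrow> pairing \<alpha> (coroot \<alpha>) = 2"
    and reflection_roots: "\<And>\<alpha>. \<alpha> \<in> \<Phi> \<Longrightarrow> reflection \<alpha> (coroot \<alpha>) ` \<Phi> = \<Phi>"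
    and coreflection_coroots:
      "\<And>\<alpha>. \<alpha> \<in> \<Phi> \<Longrightarrow> coreflection \<alpha> (coroot \<alpha>) ` (coroot ` \<Phi>) = coroot ` \<Phi>"
    and reduced: "\<And>\<alpha>. \<alpha> \<in> \<Phi> \<Longrightarrow> \<alpha> + \<alpha> \<notin> \<Phi>"
    and simple_roots: "\<Delta> \<subseteq> \<Phi>"
    and simple_independent: "zmod.independent \<Delta>"
    and simple_base: "\<And>\<beta>. \<beta> \<in> \<Phi> \<Longrightarrow>
      \<exists>c :: 'n lattice \<Rightarrow> nat.
        \<beta> = (\<Sum>\<gamma>\<in>\<Delta>. frag_cmul (int (c \<gamma>)) \<gamma>) \<or> \<beta> = - (\<Sum>\<gamma>\<in>\<Delta>. frag_cmul (int (c \<gamma>)) \<gamma>)"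

text \<open>
  A reductive group is semisimple and simply connected iff its coroots generate the
  cocharacter lattice.
\<close>

definition simply_connected_semisimple ::
    "'n::finite lattice set \<Rightarrow> ('n lattice \<Rightarrow> 'n lattice) \<Rightarrow> bool" where
  "simply_connected_semisimple \<Phi> coroot \<longleftrightarrow> zmod.span (coroot ` \<Phi>) = UNIV"

definition general_linear ::
    "'n::finite lattice set \<Rightarrow> ('n lattice \<Rightarrow> 'n lattice) \<Rightarrow> 'n lattice set \<Rightarrow> bool" where
  "general_linear \<Phi> coroot \<Delta> \<longleftrightarrow>
     (\<exists>(e :: nat \<Rightarrow> 'n lattice) (e' :: nat \<Rightarrow> 'n lattice). let n = CARD('n) in
        zmod.span (e ` {..<n}) = UNIV \<and>
        (\<forall>i<n. \<forall>j<n. pairing (e i) (e' j) = (if i = j then 1 else 0)) \<and>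
        \<Phi> = {e i - e j | i j. i < n \<and> j < n \<and> i \<noteq> j} \<and>
        (\<forall>i<n. \<forall>j<n. i \<noteq> j \<longrightarrow> coroot (e i - e j) = e' i - e' j) \<and>
        \<Delta> = {e i - e (Suc i) | i. Suc i < n})"

text \<open>The Weyl group, as a group of automorphisms of the character lattice.\<close>

inductive_set weyl_group ::
    "'n::finite lattice set \<Rightarrow> ('n lattice \<Rightarrow> 'n lattice) \<Rightarrow> ('n lattice \<Rightarrow> 'n lattice) set"
  for \<Phi> coroot where
    id: "id \<in> weyl_group \<Phi> coroot"
  | step: "\<sigma> \<in> weyl_group \<Phi> coroot \<Longrightarrow> \<alpha> \<in> \<Phi> \<Longrightarrow>
      reflection \<alpha> (coroot \<alpha>) \<circ> \<sigma> \<in> weyl_group \<Phi> coroot"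


subsection \<open>The field \<open>Frac (R(T \<times> T\<^sup>* \<times> \<complex>\<^sup>*))\<close>\<close>

text \<open>
  Characters of \<open>T \<times> T\<^sup>* \<times> \<complex>\<^sup>*\<close>: the characters of the dual torus \<open>T\<^sup>*\<close> are the cocharacters
  of \<open>T\<close>.
\<close>

datatype 'n weight =
  Weight (torus_part: "'n lattice") (dual_part: "'n lattice") (h_part: int)

instantiation weight :: (type) ab_group_add
begin

definition "0 = Weight 0 0 0"

definition "v + w = Weight (torus_part v + torus_part w) (dual_part v + dual_part w)
   (h_part v + h_part w)"

definition "- v = Weight (- torus_part v) (- dual_part v) (- h_part v)"

definition "v - w = Weight (torus_part v - torus_part w) (dual_part v - dual_part w)
   (h_part v - h_part w)"

instance
  by standard (simp_all add: zero_weight_def plus_weight_def uminus_weight_def minus_weight_def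
      algebra_simps)

end

text \<open>The lexicographic order; see the remark on \<^typ>\<open>'n\<close> above.\<close>

instantiation weight :: (linorder) linorder
begin

definition "v < w \<longleftrightarrow> torus_part v < torus_part w \<or> torus_part v = torus_part w \<and>
   (dual_part v < dual_part w \<or> dual_part v = dual_part w \<and> h_part v < h_part w)"

definition "v \<le> w \<longleftrightarrow> v = w \<or> v < (w :: 'a weight)"

instance
  by standard (auto simp: less_weight_def less_eq_weight_def intro: weight.expand)

end

instance weight :: (linorder) ordered_cancel_comm_monoid_add
  by standard (auto simp: less_eq_weight_def less_weight_def plus_weight_def)

type_synonym 'n laurent = "'n weight \<Rightarrow>\<^sub>0 int"
type_synonym 'n ratfun = "'n laurent fract"

definition character :: "'n::linorder weight \<Rightarrow> 'n ratfun" where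
  "character w = Fract (Poly_Mapping.single w 1) 1"

definition coord_h :: "'n::linorder ratfun" where
  "coord_h = character (Weight 0 0 1)"

text \<open>\<open>nu \<beta>v\<close> is the function \<open>\<lambda> \<mapsto> h\<^bsup>\<langle>\<lambda>, \<beta>v\<rangle>\<^esup>\<close>, i.e.\ the character \<open>\<beta>v\<close> of \<open>T\<^sup>*\<close>.\<close>

definition nu :: "'n::linorder lattice \<Rightarrow> 'n ratfun" where
  "nu \<beta>v = character (Weight 0 \<beta>v 0)"

definition line_char :: "'n::linorder lattice \<Rightarrow> ('n lattice \<Rightarrow> 'n lattice) \<Rightarrow> 'n ratfun" where
  "line_char \<alpha> \<sigma> = character (Weight (- \<sigma> \<alpha>) 0 0)"

definition lambda_h_functions :: "'n::linorder ratfun set" where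
  "lambda_h_functions = {Fract p r | p r. r \<noteq> 0 \<and>
     (\<forall>w \<in> Poly_Mapping.keys p \<union> Poly_Mapping.keys r. torus_part w = 0)}"

text \<open>
  An injective endomorphism \<open>g\<close> of the character group induces \<open>e\<^sup>w \<mapsto> e\<^bsup>g w\<^esup>\<close> on the group ring
  and on its field of fractions. The description in \<open>ratfun_subst\<close> is meaningful by
  lemma \<open>ratfun_subst_Fract\<close>.
\<close>

definition laurent_subst :: "('n weight \<Rightarrow> 'n weight) \<Rightarrow> 'n laurent \<Rightarrow> 'n laurent" where
  "laurent_subst g p = (\<Sum>w\<in>Poly_Mapping.keys p. Poly_Mapping.single (g w) (Poly_Mapping.lookup p w))"

definition ratfun_subst ::
    "('n::linorder weight \<Rightarrow> 'n weight) \<Rightarrow> 'n ratfun \<Rightarrow> 'n ratfun" where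
  "ratfun_subst g z = (THE y. \<exists>p r. r \<noteq> 0 \<and> z = Fract p r \<and>
     y = Fract (laurent_subst g p) (laurent_subst g r))"

lemma laurent_subst_superset:
  assumes "finite A" "Poly_Mapping.keys p \<subseteq> A"
  shows "laurent_subst g p = (\<Sum>w\<in>A. Poly_Mapping.single (g w) (Poly_Mapping.lookup p w))"
  unfolding laurent_subst_def
  by (rule sum.mono_neutral_left) (use assms in \<open>auto simp: in_keys_iff\<close>)

lemma laurent_subst_single:
  "laurent_subst g (Poly_Mapping.single w c) = Poly_Mapping.single (g w) c"
  by (subst laurent_subst_superset[where A = "{w}"]) auto

lemma laurent_subst_0: "laurent_subst g 0 = 0"
  by (simp add: laurent_subst_def)

lemma laurent_subst_add: "laurent_subst g (p + r) = laurent_subst g p + laurent_subst g r"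
proof -
  have "Poly_Mapping.keys (p + r) \<subseteq> Poly_Mapping.keys p \<union> Poly_Mapping.keys r" by (rule Poly_Mapping.keys_add)
  then show ?thesis
    by (simp add: laurent_subst_superset[where A = "Poly_Mapping.keys p \<union> Poly_Mapping.keys r"] lookup_add single_add
        sum.distrib)
qed

lemma laurent_subst_sum: "laurent_subst g (sum f A) = (\<Sum>x\<in>A. laurent_subst g (f x))"
  by (induction A rule: infinite_finite_induct) (simp_all add: laurent_subst_0 laurent_subst_add)

lemma laurent_sum_monomials:
  "(\<Sum>w\<in>Poly_Mapping.keys p. Poly_Mapping.single w (Poly_Mapping.lookup p w)) = p"
  by (rule poly_mapping_eqI) (simp add: lookup_sum lookup_single when_def in_keys_iff)

lemma laurent_subst_mult:
  assumes "\<And>v w. g (v + w) = g v + g w"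
  shows "laurent_subst g (p * r) = laurent_subst g p * laurent_subst g r"
proof -
  have "laurent_subst g (p * r) =
      laurent_subst g ((\<Sum>v\<in>Poly_Mapping.keys p. Poly_Mapping.single v (Poly_Mapping.lookup p v)) *
        (\<Sum>w\<in>Poly_Mapping.keys r. Poly_Mapping.single w (Poly_Mapping.lookup r w)))"
    by (simp add: laurent_sum_monomials)
  also have "\<dots> = laurent_subst g p * laurent_subst g r"
    by (simp add: sum_product laurent_subst_sum Poly_Mapping.mult_single laurent_subst_single assms)
      (simp add: laurent_subst_def sum_product Poly_Mapping.mult_single)
  finally show ?thesis .
qed

lemma laurent_subst_eq_0_iff:
  assumes "inj g"
  shows "laurent_subst g p = 0 \<longleftrightarrow> p = 0"
proof
  assume *: "laurent_subst g p = 0"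
  show "p = 0"
  proof (rule poly_mapping_eqI)
    fix w
    have "Poly_Mapping.lookup (laurent_subst g p) (g w) =
        (\<Sum>v\<in>Poly_Mapping.keys p. if v = w then Poly_Mapping.lookup p v else 0)"
      unfolding laurent_subst_def lookup_sum
      by (rule sum.cong) (auto simp: lookup_single when_def inj_eq[OF assms])
    also have "\<dots> = Poly_Mapping.lookup p w" by (simp add: in_keys_iff)
    finally show "Poly_Mapping.lookup p w = Poly_Mapping.lookup 0 w" using * by simp
  qed
qed (simp add: laurent_subst_0)

lemma ratfun_subst_Fract:
  assumes "\<And>v w. g (v + w) = g v + g w" "inj g" "r \<noteq> 0"
  shows "ratfun_subst g (Fract p r) = Fract (laurent_subst g p) (laurent_subst g r)"
  unfolding ratfun_subst_def
proof (rule the_equality)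
  show "\<exists>p' r'. r' \<noteq> 0 \<and> Fract p r = Fract p' r' \<and>
    Fract (laurent_subst g p) (laurent_subst g r) =
    Fract (laurent_subst g p') (laurent_subst g r')"
    using assms(3) by blast
next
  fix y
  assume "\<exists>p' r'. r' \<noteq> 0 \<and> Fract p r = Fract p' r' \<and>
    y = Fract (laurent_subst g p') (laurent_subst g r')"
  then obtain p' r' where 1: "r' \<noteq> 0" "Fract p r = Fract p' r'"
      "y = Fract (laurent_subst g p') (laurent_subst g r')" by blast
  then have "laurent_subst g (p * r') = laurent_subst g (p' * r)"
    using assms(3) by (simp add: eq_fract)
  then show "y = Fract (laurent_subst g p) (laurent_subst g r)"
    using 1 assms by (simp add: eq_fract laurent_subst_mult laurent_subst_eq_0_iff)
qed

text \<open>
  \<open>f(\<lambda>) \<mapsto> f(s\<^sub>\<alpha>\<lambda>)\<close>: as \<open>\<langle>s\<^sub>\<alpha>\<lambda>, y\<rangle> = \<langle>\<lambda>, y - \<langle>\<alpha>, y\<rangle>\<alpha>v\<rangle>\<close>, this replaces the character \<open>y\<close> of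
  \<open>T\<^sup>*\<close> by its coreflection, and leaves \<open>T\<close>, \<open>h\<close> and \<open>q\<close> alone.
\<close>

definition lambda_reflect_weight ::
    "'n::finite lattice \<Rightarrow> 'n lattice \<Rightarrow> 'n weight \<Rightarrow> 'n weight" where
  "lambda_reflect_weight \<alpha> \<alpha>v w =
     Weight (torus_part w) (coreflection \<alpha> \<alpha>v (dual_part w)) (h_part w)"

definition lambda_reflect ::
    "'n::{finite,linorder} lattice \<Rightarrow> 'n lattice \<Rightarrow> 'n ratfun fps \<Rightarrow> 'n ratfun fps" where
  "lambda_reflect \<alpha> \<alpha>v f =
     Abs_fps (\<lambda>m. ratfun_subst (lambda_reflect_weight \<alpha> \<alpha>v) (fps_nth f m))"


subsection \<open>The operators\<close>

text \<open>
  An element of the direct sum over the (finite) Weyl group \<open>W\<close> is a function in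
  \<open>W \<rightarrow>\<^sub>E UNIV\<close>. In \<open>\<sigma> \<circ> s\<^sub>\<alpha>\<close>, \<open>s\<^sub>\<alpha>\<close> acts first.
\<close>

definition C_op ::
    "'n::{finite,linorder} lattice set \<Rightarrow> ('n lattice \<Rightarrow> 'n lattice) \<Rightarrow> 'n lattice \<Rightarrow>
     (('n lattice \<Rightarrow> 'n lattice) \<Rightarrow> 'n ratfun fps) \<Rightarrow>
     ('n lattice \<Rightarrow> 'n lattice) \<Rightarrow> 'n ratfun fps" where
  "C_op \<Phi> coroot \<alpha> f = (\<lambda>\<sigma>\<in>weyl_group \<Phi> coroot.
     delta (line_char \<alpha> \<sigma>) (nu (coroot \<alpha>)) * lambda_reflect \<alpha> (coroot \<alpha>) (f \<sigma>) +
     delta (line_char \<alpha> \<sigma>) coord_h *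
       lambda_reflect \<alpha> (coroot \<alpha>) (f (\<sigma> \<circ> reflection \<alpha> (coroot \<alpha>))))"

definition kappa :: "'n::linorder lattice \<Rightarrow> 'n ratfun fps" where
  "kappa \<alpha>v = delta coord_h (nu \<alpha>v) * delta coord_h (1 / nu \<alpha>v)"

end

theory Submission
  imports Defs
begin

text \<open>
  Expanding \<open>C\<^sub>k \<circ> C\<^sub>k\<close>, the coefficient of \<open>f\<close> at \<open>\<sigma> s\<^sub>k\<close> vanishes because \<open>\<vartheta>\<close> is odd, so that
  \<open>\<delta>(1/a, 1/b) = - \<delta>(a, b)\<close>, and the coefficient at \<open>\<sigma>\<close> is
  \<open>\<delta>(L,\<nu>) \<delta>(L,1/\<nu>) + \<delta>(h,L) \<delta>(h,1/L)\<close>. By the Jacobi triple product \<open>\<vartheta>\<close> is, up to a factor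
  independent of \<open>x\<close>, a theta series, and rearranging the product of two such series gives
  \<open>\<vartheta>(ab) \<vartheta>(a/b) = A(a) B(b) - A(b) B(a)\<close> up to the same factor squared, with \<open>A\<close>, \<open>B\<close> theta
  series of nome \<open>q\<^sup>2\<close>. Hence the equality of this coefficient with \<open>\<delta>(h,\<nu>) \<delta>(h,1/\<nu>)\<close> is a
  Pluecker relation between two by two minors.
\<close>

subsection \<open>The Jacobi triple product\<close>

definition theta_factor :: "'a::{comm_ring_1,inverse} \<Rightarrow> nat \<Rightarrow> 'a fps" where
  "theta_factor x n =
     (1 - fps_X ^ Suc n * fps_const x) * (1 - fps_X ^ Suc n * fps_const (inverse x))"

text \<open>Each factor is 1 modulo q^(n+1), so multiplying by it leaves the lower coefficients
  alone.\<close>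

lemma fps_nth_mult_theta_factor:
  assumes "m \<le> n"
  shows "fps_nth (f * theta_factor x n) m = fps_nth f m"
proof -
  have "f * ((1 - y * c) * (1 - y * d)) = f - y * (f * (c + d - c * (y * d)))" for y c d :: "'a fps"
    by (simp add: algebra_simps)
  then have "f * theta_factor x n = f - fps_X ^ Suc n *
      (f * (fps_const x + fps_const (inverse x) -
        fps_const x * (fps_X ^ Suc n * fps_const (inverse x))))"
    unfolding theta_factor_def by blast
  then show ?thesis
    using assms by (simp add: fps_X_power_mult_nth del: power_Suc)
qed

lemma fps_nth_prod_theta_factor:
  "m \<le> N \<Longrightarrow> fps_nth (\<Prod>n<N. theta_factor x n) m = fps_nth (\<Prod>n<m. theta_factor x n) m"
  by (induction N rule: dec_induct) (simp_all add: fps_nth_mult_theta_factor)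

text \<open>Coefficient \<open>m\<close> of the partial products is constant from \<open>m\<close>
  factors on, so the q-adic limit can be read off along the diagonal.\<close>

lemma prodinf_theta_factor:
  fixes x :: "'a::{idom,inverse}"
  shows "prodinf (theta_factor x) = Abs_fps (\<lambda>m. fps_nth (\<Prod>n<m. theta_factor x n) m)"
    (is "_ = ?L")
proof -
  have lim: "(\<lambda>N. \<Prod>n\<le>N. theta_factor x n) \<longlonglongrightarrow> ?L"
  proof (rule tendsto_fpsI)
    fix m
    have "fps_nth (\<Prod>n\<le>N. theta_factor x n) m = fps_nth ?L m" if "m \<le> N" for N
      using fps_nth_prod_theta_factor[of m "Suc N" x] that by (simp only: lessThan_Suc_atMost) simp
    then show "\<forall>\<^sub>F N in sequentially. fps_nth (\<Prod>n\<le>N. theta_factor x n) m = fps_nth ?L m"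
      unfolding eventually_sequentially by blast
  qed
  \<comment> \<open>\<open>has_prod\<close> has a second alternative, the value 0 caused by a
    vanishing factor; excluding it makes the value unique.\<close>
  have nz: "theta_factor x n \<noteq> 0" for n
  proof -
    have "fps_nth (theta_factor x n) 0 = 1" by (simp add: theta_factor_def)
    then show ?thesis by auto
  qed
  have "fps_nth ?L 0 = 1" by simp
  then have "?L \<noteq> 0" by (metis fps_zero_nth zero_neq_one)
  then have "theta_factor x has_prod ?L"
    using lim by (simp add: has_prod_def raw_has_prod_def)
  moreover have "p = ?L" if "theta_factor x has_prod p" for p
    using that nz LIMSEQ_unique[OF _ lim] by (auto simp: has_prod_def raw_has_prod_def)
  ultimately show ?thesis unfolding prodinf_def by (rule the_equality)
qed

lemma theta_red_nth:
  fixes x :: "'a::{idom,inverse}"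
  assumes "m \<le> N"
  shows "fps_nth (theta_red x) m = (1 - inverse x) * fps_nth (\<Prod>n<N. theta_factor x n) m"
proof -
  have "theta_red x = fps_const (1 - inverse x) * prodinf (theta_factor x)"
    unfolding theta_red_def theta_factor_def by simp
  then show ?thesis
    by (simp add: prodinf_theta_factor fps_nth_prod_theta_factor[OF assms])
qed

text \<open>This is the oddness of \<vartheta>: the product is symmetric under x -> 1/x, so only the
  prefactor changes, and the root x^(1/2) left out of \<open>theta_red\<close> accounts for the
  extra factor x.\<close>

lemma theta_red_inverse:
  fixes x :: "'a::field"
  assumes "x \<noteq> 0"
  shows "theta_red (inverse x) = - (fps_const x * theta_red x)"
proof (rule fps_ext)
  fix m
  have "theta_factor (inverse x) = theta_factor x"
    by (simp add: fun_eq_iff theta_factor_def)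
  then show "fps_nth (theta_red (inverse x)) m = fps_nth (- (fps_const x * theta_red x)) m"
    using assms by (simp add: theta_red_nth[OF order.refl] field_simps)
qed

lemma theta_red_nth_0: "fps_nth (theta_red x) 0 = 1 - inverse x"
  for x :: "'a::{idom,inverse}"
  by (simp add: theta_red_nth[OF order.refl])

text \<open>\<open>qbinom a b\<close> is the Gaussian binomial coefficient \<open>[a + b, a]\<close>.\<close>

fun qbinom :: "nat \<Rightarrow> nat \<Rightarrow> 'a::comm_ring_1 fps" where
  "qbinom 0 b = 1"
| "qbinom (Suc a) 0 = 1"
| "qbinom (Suc a) (Suc b) = qbinom a (Suc b) + fps_X ^ Suc a * qbinom (Suc a) b"

lemma qbinom_0_right [simp]: "qbinom a 0 = 1"
  by (cases a) simp_all

text \<open>The q-analogue of (a+1) C(a+b+1, a+1) = (b+1) C(a+b+1, a). Together with the defining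
  Pascal rule it yields the mirrored one, \<open>qbinom_Suc_Suc'\<close>.\<close>

lemma qbinom_absorb:
  "(1 - fps_X ^ Suc a) * qbinom (Suc a) b = (1 - fps_X ^ Suc b) * (qbinom a (Suc b) :: 'a::comm_ring_1 fps)"
proof (induction a b rule: qbinom.induct)
  case (1 b)
  show ?case
  proof (induction b)
    case (Suc b)
    have "(1 - fps_X ^ Suc 0) * qbinom (Suc 0) (Suc b) =
      (1 - fps_X) + fps_X * ((1 - fps_X ^ Suc 0) * qbinom (Suc 0) b :: 'a fps)"
      by (simp add: algebra_simps)
    also have "\<dots> = 1 - fps_X ^ Suc (Suc b)"
      unfolding Suc.IH by (simp add: algebra_simps)
    finally show ?case by simp
  qed simp
next
  case (2 a)
  have "(1 - fps_X ^ Suc 0) * (qbinom (Suc a) (Suc 0) :: 'a fps) = 1 - fps_X ^ Suc (Suc a)" for a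
  proof (induction a)
    case 0
    then show ?case by (simp add: algebra_simps)
  next
    case (Suc a)
    have "(1 - fps_X ^ Suc 0) * (qbinom (Suc (Suc a)) (Suc 0) :: 'a fps) =
      (1 - fps_X ^ Suc 0) * qbinom (Suc a) (Suc 0) + (1 - fps_X) * fps_X ^ Suc (Suc a)"
      by (subst qbinom.simps(3)) (simp add: algebra_simps del: qbinom.simps(3))
    also have "\<dots> = 1 - fps_X ^ Suc (Suc (Suc a))"
      unfolding Suc by (simp add: algebra_simps)
    finally show ?case .
  qed
  then show ?case by (simp del: qbinom.simps(3) power_Suc)
next
  case (3 a b)
  define u v w where "u = (fps_X ^ Suc a :: 'a fps)" "v = (fps_X ^ Suc b :: 'a fps)"
    "w = (qbinom (Suc a) (Suc b) :: 'a fps)"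
  have 1: "(1 - u) * w = (1 - fps_X * v) * qbinom a (Suc (Suc b))"
    using 3(1) by (simp add: u_v_w_def)
  have 2: "(1 - fps_X * u) * qbinom (Suc (Suc a)) b = (1 - v) * w"
    using 3(2) by (simp add: u_v_w_def)
  have "(1 - fps_X * u) * qbinom (Suc (Suc a)) (Suc b) =
      (1 - fps_X * u) * w + fps_X * u * ((1 - fps_X * u) * qbinom (Suc (Suc a)) b)"
    by (simp add: u_v_w_def algebra_simps)
  also have "\<dots> = (1 - u) * w + u * ((1 - fps_X * v) * w)"
    unfolding 2 by (simp add: algebra_simps)
  also have "\<dots> = (1 - fps_X * v) * (qbinom a (Suc (Suc b)) + u * w)"
    unfolding 1 by (simp add: algebra_simps)
  also have "qbinom a (Suc (Suc b)) + u * w = qbinom (Suc a) (Suc (Suc b))"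
    by (simp add: u_v_w_def)
  finally show ?case by (simp add: u_v_w_def)
qed

lemma qbinom_Suc_Suc':
  "(qbinom (Suc a) (Suc b) :: 'a::comm_ring_1 fps) =
     qbinom (Suc a) b + fps_X ^ Suc b * qbinom a (Suc b)"
  using qbinom_absorb[of a b, where 'a = 'a] by (simp add: algebra_simps)

lemma qbinom_nth_Suc_left:
  "i \<le> a \<Longrightarrow> fps_nth (qbinom (Suc a) b) i = fps_nth (qbinom a b) i"
  by (cases b) (simp_all add: fps_X_power_mult_nth del: power_Suc)

lemma qbinom_nth_Suc_right:
  "i \<le> b \<Longrightarrow> fps_nth (qbinom a (Suc b)) i = fps_nth (qbinom a b) i"
  by (cases a) (simp_all add: qbinom_Suc_Suc' fps_X_power_mult_nth del: power_Suc qbinom.simps(3))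

text \<open>The generating series of partitions, as the limit of \<open>qbinom a b\<close> when both
  arguments grow. By the two Pascal rules coefficient \<open>i\<close> is already stable at
  \<open>a = b = i\<close>, whence the diagonal.\<close>

definition partition_series :: "'a::comm_ring_1 fps" where
  "partition_series = Abs_fps (\<lambda>i. fps_nth (qbinom i i) i)"

lemma qbinom_nth_stable:
  assumes "i \<le> a" "i \<le> b"
  shows "fps_nth (qbinom a b) i = fps_nth partition_series i"
proof -
  have "fps_nth (qbinom a b) i = fps_nth (qbinom i b) i"
    using assms(1) by (induction a rule: dec_induct) (simp_all add: qbinom_nth_Suc_left)
  also have "\<dots> = fps_nth (qbinom i i) i"
    using assms(2) by (induction b rule: dec_induct) (simp_all add: qbinom_nth_Suc_right)
  finally show ?thesis by (simp add: partition_series_def)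
qed

lemma partition_series_nonzero: "partition_series \<noteq> (0 :: 'a::comm_ring_1 fps)"
proof -
  have "fps_nth partition_series 0 = (1 :: 'a)" by (simp add: partition_series_def)
  then show ?thesis by auto
qed

definition triangle :: "int \<Rightarrow> nat" where
  "triangle j = nat (j * (j + 1) div 2)"

lemma double_triangle: "2 * int (triangle j) = j * (j + 1)"
proof -
  have "0 \<le> j * (j + 1)" by (cases "j \<ge> 0") (auto simp: zero_le_mult_iff)
  moreover have "even (j * (j + 1))" by simp
  ultimately show ?thesis unfolding triangle_def by auto
qed

lemma triangle_eqI: "2 * int n = j * (j + 1) \<Longrightarrow> triangle j = n"
  using double_triangle[of j] by linarith

text \<open>For j >= 0 this comes from j^2 >= j, for j < 0 from (j+1)(j+2) >= 0. It confines the
  terms of a theta series that contribute to a given power of q to a finite window.\<close>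

lemma abs_le_Suc_triangle: "\<bar>j\<bar> \<le> int (triangle j) + 1"
proof -
  have "2 * \<bar>j\<bar> \<le> j * (j + 1) + 2"
  proof (cases "j \<ge> 0")
    case True
    then have "j * j \<ge> j * 1" by (cases "j = 0") (auto intro!: mult_left_mono)
    then show ?thesis using True by (simp add: algebra_simps)
  next
    case False
    have "0 \<le> (- j - 1) * (- j - 2)"
      using False by (cases "j = -1") (auto intro!: mult_nonneg_nonneg)
    then show ?thesis using False by (simp add: algebra_simps)
  qed
  then show ?thesis using double_triangle[of j] by linarith
qed

section \<open>Cauchy's finite form of the triple product\<close>

context
  fixes x :: "'a::field"
  assumes x: "x \<noteq> 0"
begin

text \<open>Term j in the expansion of (1 - q x) ... (1 - q^M x) times (1 - 1/x) ... (1 -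
  q^(N-1)/x). The value 0 outside the range lets the recursions in M and N hold for every integer j
  and the sums be shifted freely.\<close>

definition jterm :: "nat \<Rightarrow> nat \<Rightarrow> int \<Rightarrow> 'a fps" where
  "jterm M N j = (if - int N \<le> j \<and> j \<le> int M then
     fps_const ((- x) powi j) * (fps_X ^ triangle j * qbinom (nat (int N + j)) (nat (int M - j)))
     else 0)"

text \<open>M enters the second argument of \<open>qbinom\<close>, so this is the mirrored Pascal
  rule; the powers of q match because the triangular numbers at j and j - 1 differ by j.\<close>

lemma jterm_Suc_left:
  "jterm (Suc M) N j = jterm M N j - fps_X ^ Suc M * fps_const x * jterm M N (j - 1)"
proof (cases "- int N \<le> j \<and> j \<le> int M + 1")
  case False
  then show ?thesis by (auto simp: jterm_def)
next
  case bounds: True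
  have pow: "(- x) powi j = - (x * (- x) powi (j - 1))"
    using x power_int_add[of "-x" "j - 1" 1] by simp
  have tri: "int (triangle (j - 1)) = int (triangle j) - j"
    using double_triangle[of j] double_triangle[of "j - 1"] by (simp add: algebra_simps)
  \<comment> \<open>The first case is contradictory. At the ends j = M + 1 and j = -N one term on
    the right is 0 by convention; only the last case needs the Pascal rule.\<close>
  consider "j = int M + 1" "j = - int N" | "j = int M + 1" "- int N < j"
    | "j = - int N" "j \<le> int M" | "- int N < j" "j \<le> int M"
    using bounds by linarith
  then show ?thesis
  proof cases
    case 2
    have "triangle j = Suc M + triangle (j - 1)" using tri 2 by linarith
    then show ?thesis using 2 pow by (simp add: jterm_def power_add mult_ac flip: fps_const_mult fps_const_neg)
  next
    case 4
    define a b where "a = nat (int N + j - 1)" and "b = nat (int M - j)"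
    have ab: "nat (int N + j) = Suc a" "nat (int N + (j - 1)) = a" "nat (int (Suc M) - j) = Suc b"
      "nat (int M - (j - 1)) = Suc b" "nat (int M - j) = b"
      using 4 by (auto simp: a_def b_def)
    have "Suc M + triangle (j - 1) = triangle j + Suc b"
      using tri ab 4 by linarith
    then have "fps_X ^ Suc M * fps_X ^ triangle (j - 1) = (fps_X ^ triangle j * fps_X ^ Suc b :: 'a fps)"
      by (simp only: flip: power_add)
    define A :: "'a fps" where "A = fps_X ^ triangle j"
    define Y :: "'a fps" where "Y = fps_X ^ Suc b"
    define c where "c = fps_const ((- x) powi j)"
    define d where "d = fps_const ((- x) powi (j - 1))"
    have XAY: "fps_X ^ Suc M * fps_X ^ triangle (j - 1) = A * Y"
      unfolding A_def Y_def using \<open>Suc M + _ = _\<close> by (simp only: flip: power_add)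
    have c: "c = - (fps_const x * d)"
      by (simp add: c_def d_def pow flip: fps_const_mult fps_const_neg)
    have 1: "jterm (Suc M) N j = c * (A * qbinom (Suc a) (Suc b))"
      and 2: "jterm M N j = c * (A * qbinom (Suc a) b)"
      and 3: "jterm M N (j - 1) = d * (fps_X ^ triangle (j - 1) * qbinom a (Suc b))"
      using 4 by (simp_all add: jterm_def ab ab[simplified] A_def c_def d_def del: qbinom.simps)
    have "fps_X ^ Suc M * fps_const x * jterm M N (j - 1) =
      fps_const x * d * ((fps_X ^ Suc M * fps_X ^ triangle (j - 1)) * qbinom a (Suc b))"
      unfolding 3 by (simp only: mult_ac)
    then show ?thesis
      unfolding 1 2 XAY qbinom_Suc_Suc' c Y_def[symmetric] by (simp add: algebra_simps)
  qed (use bounds in \<open>auto simp: jterm_def\<close>)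
qed

text \<open>Here N enters the first argument of \<open>qbinom\<close>, so the defining Pascal rule
  takes the place of the mirrored one.\<close>

lemma jterm_Suc_right:
  "jterm M (Suc N) j = jterm M N j - fps_X ^ N * fps_const (inverse x) * jterm M N (j + 1)"
proof (cases "- int N - 1 \<le> j \<and> j \<le> int M")
  case False
  then show ?thesis by (auto simp: jterm_def)
next
  case bounds: True
  have pow: "(- x) powi j = - (inverse x * (- x) powi (j + 1))"
    using x power_int_add[of "-x" j 1] by (simp add: field_simps)
  have tri: "int (triangle (j + 1)) = int (triangle j) + j + 1"
    using double_triangle[of j] double_triangle[of "j + 1"] by (simp add: algebra_simps)
  consider "j = - int N - 1" "j = int M" | "j = - int N - 1" "j < int M"
    | "j = int M" "- int N \<le> j" | "- int N \<le> j" "j < int M"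
    using bounds by linarith
  then show ?thesis
  proof cases
    case 2
    have "triangle j = N + triangle (j + 1)" using tri 2 by linarith
    then show ?thesis using 2 pow by (simp add: jterm_def power_add mult_ac flip: fps_const_mult fps_const_neg)
  next
    case 4
    define a b where "a = nat (int N + j)" and "b = nat (int M - j - 1)"
    have ab: "nat (int (Suc N) + j) = Suc a" "nat (int N + (j + 1)) = Suc a" "nat (int N + j) = a"
      "nat (int M - (j + 1)) = b" "nat (int M - j) = Suc b"
      using 4 by (auto simp: a_def b_def)
    have "N + triangle (j + 1) = triangle j + Suc a"
      using tri ab 4 by linarith
    define A :: "'a fps" where "A = fps_X ^ triangle j"
    define Y :: "'a fps" where "Y = fps_X ^ Suc a"
    define c where "c = fps_const ((- x) powi j)"
    define d where "d = fps_const ((- x) powi (j + 1))"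
    have XAY: "fps_X ^ N * fps_X ^ triangle (j + 1) = A * Y"
      unfolding A_def Y_def using \<open>N + _ = _\<close> by (simp only: flip: power_add)
    have c: "c = - (fps_const (inverse x) * d)"
      by (simp add: c_def d_def pow flip: fps_const_mult fps_const_neg)
    have 1: "jterm M (Suc N) j = c * (A * qbinom (Suc a) (Suc b))"
      and 2: "jterm M N j = c * (A * qbinom a (Suc b))"
      and 3: "jterm M N (j + 1) = d * (fps_X ^ triangle (j + 1) * qbinom (Suc a) b)"
      using 4 by (simp_all add: jterm_def ab ab[simplified] A_def c_def d_def del: qbinom.simps)
    have "fps_X ^ N * fps_const (inverse x) * jterm M N (j + 1) =
      fps_const (inverse x) * d * ((fps_X ^ N * fps_X ^ triangle (j + 1)) * qbinom (Suc a) b)"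
      unfolding 3 by (simp only: mult_ac)
    then show ?thesis
      unfolding 1 2 XAY qbinom.simps c Y_def[symmetric] by (simp add: algebra_simps)
  qed (use bounds in \<open>auto simp: jterm_def\<close>)
qed

lemma sum_jterm_eq:
  assumes "finite S" "{- int N..int M} \<subseteq> S"
  shows "sum (jterm M N) S = (\<Sum>j = - int N..int M. jterm M N j)"
  by (rule sum.mono_neutral_right) (use assms in \<open>auto simp: jterm_def\<close>)

lemma sum_jterm_Suc_left:
  "(\<Sum>j = - int N..int (Suc M). jterm (Suc M) N j) =
     (\<Sum>j = - int N..int M. jterm M N j) * (1 - fps_X ^ Suc M * fps_const x)"
proof -
  have "(\<Sum>j = - int N..int (Suc M). jterm M N (j - 1)) = sum (jterm M N) {- int N - 1..int M}"
    by (rule sum.reindex_bij_witness[where i = "\<lambda>j. j + 1" and j = "\<lambda>j. j - 1"]) auto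
  also have "\<dots> = (\<Sum>j = - int N..int M. jterm M N j)" by (rule sum_jterm_eq) auto
  finally have shift: "(\<Sum>j = - int N..int (Suc M). jterm M N (j - 1)) =
    (\<Sum>j = - int N..int M. jterm M N j)" .
  have "(\<Sum>j = - int N..int (Suc M). jterm M N j) = (\<Sum>j = - int N..int M. jterm M N j)"
    by (rule sum_jterm_eq) auto
  then have "(\<Sum>j = - int N..int (Suc M). jterm (Suc M) N j) = (\<Sum>j = - int N..int M. jterm M N j) -
      fps_X ^ Suc M * fps_const x * (\<Sum>j = - int N..int M. jterm M N j)"
    by (simp only: jterm_Suc_left sum_subtractf shift flip: sum_distrib_left)
  then show ?thesis by (simp only: left_diff_distrib mult_1_left mult.commute)
qed

lemma sum_jterm_Suc_right:
  "(\<Sum>j = - int (Suc N)..int M. jterm M (Suc N) j) =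
     (\<Sum>j = - int N..int M. jterm M N j) * (1 - fps_X ^ N * fps_const (inverse x))"
proof -
  have "(\<Sum>j = - int (Suc N)..int M. jterm M N (j + 1)) = sum (jterm M N) {- int N..int M + 1}"
    by (rule sum.reindex_bij_witness[where i = "\<lambda>j. j - 1" and j = "\<lambda>j. j + 1"]) auto
  also have "\<dots> = (\<Sum>j = - int N..int M. jterm M N j)" by (rule sum_jterm_eq) auto
  finally have shift: "(\<Sum>j = - int (Suc N)..int M. jterm M N (j + 1)) =
    (\<Sum>j = - int N..int M. jterm M N j)" .
  have "(\<Sum>j = - int (Suc N)..int M. jterm M N j) = (\<Sum>j = - int N..int M. jterm M N j)"
    by (rule sum_jterm_eq) auto
  then have "(\<Sum>j = - int (Suc N)..int M. jterm M (Suc N) j) = (\<Sum>j = - int N..int M. jterm M N j) -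
      fps_X ^ N * fps_const (inverse x) * (\<Sum>j = - int N..int M. jterm M N j)"
    by (simp only: jterm_Suc_right sum_subtractf shift flip: sum_distrib_left)
  then show ?thesis by (simp only: left_diff_distrib mult_1_left mult.commute)
qed

text \<open>The second index runs one ahead because its factors begin with 1 - q^0/x, the prefactor
  of \<open>theta_red\<close>; the remaining factors pair up into
  \<open>theta_factor\<close>.\<close>

lemma finite_triple_product:
  "(\<Sum>j = - int (Suc N)..int N. jterm N (Suc N) j) =
     fps_const (1 - inverse x) * (\<Prod>n<N. theta_factor x n)"
proof (induction N)
  case 0
  have "{- 1..0} = {-1, 0 :: int}" by auto
  then show ?case
    by (simp add: jterm_def triangle_def flip: fps_const_sub)
next
  case (Suc N)
  have "(\<Sum>j = - int (Suc (Suc N))..int (Suc N). jterm (Suc N) (Suc (Suc N)) j) =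
     (\<Sum>j = - int (Suc N)..int N. jterm N (Suc N) j) * theta_factor x N"
    unfolding sum_jterm_Suc_left sum_jterm_Suc_right theta_factor_def
    by (simp only: mult_ac)
  also have "\<dots> = fps_const (1 - inverse x) * (\<Prod>n<Suc N. theta_factor x n)"
    unfolding Suc.IH by (simp add: mult.assoc)
  finally show ?case .
qed

end

section \<open>Series with general exponents, and the triple product in the limit\<close>

definition qsum :: "('i \<Rightarrow> nat) \<Rightarrow> ('i \<Rightarrow> 'a::comm_ring_1) \<Rightarrow> 'a fps" where
  "qsum e c = Abs_fps (\<lambda>m. \<Sum>i | e i = m. c i)"

text \<open>The Cauchy product regrouped by total exponent. Finite fibres matter: a sum over an
  infinite set is 0 by convention, so only with them is \<open>qsum\<close> the formal sum.\<close>

lemma qsum_mult: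
  assumes "\<And>m. finite {i. e i = m}" "\<And>m. finite {j. e' j = m}"
  shows "qsum e c * qsum e' c' = qsum (\<lambda>(i, j). e i + e' j) (\<lambda>(i, j). c i * c' j)"
proof (rule fps_ext)
  fix m
  have "fps_nth (qsum e c * qsum e' c') m =
      (\<Sum>k\<le>m. \<Sum>p\<in>{i. e i = k} \<times> {j. e' j = m - k}. case p of (i, j) \<Rightarrow> c i * c' j)"
    by (simp add: fps_mult_nth qsum_def sum_product sum.cartesian_product atLeast0AtMost)
  also have "\<dots> = (\<Sum>p\<in>(\<Union>k\<le>m. {i. e i = k} \<times> {j. e' j = m - k}). case p of (i, j) \<Rightarrow> c i * c' j)"
    by (rule sum.UNION_disjoint[symmetric]) (use assms in auto)
  also have "(\<Union>k\<le>m. {i. e i = k} \<times> {j. e' j = m - k}) = {p. (case p of (i, j) \<Rightarrow> e i + e' j) = m}"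
    by auto
  finally show "fps_nth (qsum e c * qsum e' c') m =
      fps_nth (qsum (\<lambda>(i, j). e i + e' j) (\<lambda>(i, j). c i * c' j)) m"
    by (simp add: qsum_def)
qed

lemma qsum_const_mult: "fps_const b * qsum e c = qsum e (\<lambda>i. b * c i)"
  by (rule fps_ext) (simp add: qsum_def sum_distrib_left)

lemma qsum_split:
  assumes "\<And>m. finite {i. e i = m}"
    and "inj g" "inj g'" "range g \<inter> range g' = {}" "range g \<union> range g' = UNIV"
  shows "qsum e c = qsum (e \<circ> g) (c \<circ> g) + qsum (e \<circ> g') (c \<circ> g')"
proof (rule fps_ext)
  fix m
  have *: "{i. e i = m} = g ` {i. e (g i) = m} \<union> g' ` {i. e (g' i) = m}"
    using assms(5) by auto
  have fin: "finite (g ` {i. e (g i) = m})" "finite (g' ` {i. e (g' i) = m})"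
    using assms(1)[of m] unfolding * by auto
  have "(\<Sum>i | e i = m. c i) = sum c (g ` {i. e (g i) = m}) + sum c (g' ` {i. e (g' i) = m})"
    unfolding * using fin assms(4) by (intro sum.union_disjoint) auto
  also have "\<dots> = (\<Sum>i | e (g i) = m. c (g i)) + (\<Sum>i | e (g' i) = m. c (g' i))"
    using assms(2,3) by (simp add: sum.reindex inj_on_subset[of _ UNIV])
  finally show "fps_nth (qsum e c) m = fps_nth (qsum (e \<circ> g) (c \<circ> g) + qsum (e \<circ> g') (c \<circ> g')) m"
    by (simp add: qsum_def)
qed

lemma finite_triangle_eq: "finite {j. triangle j = m}"
proof (rule finite_subset)
  show "{j. triangle j = m} \<subseteq> {- int m - 1..int m + 1}"
  proof
    fix j assume "j \<in> {j. triangle j = m}"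
    then show "j \<in> {- int m - 1..int m + 1}"
      using abs_le_Suc_triangle[of j] by auto
  qed
qed simp

definition theta_series :: "'a::field \<Rightarrow> 'a fps" where
  "theta_series x = qsum triangle (\<lambda>j. (- x) powi j)"

text \<open>Each coefficient m is settled by the finite identity with N = m + 1: all j with
  \<open>triangle j \<le> m\<close> lie in its window, and their Gaussian binomials are stable up to
  the degree \<open>m - triangle j\<close> that counts.\<close>

theorem jacobi_triple_product:
  fixes x :: "'a::field"
  assumes x: "x \<noteq> 0"
  shows "theta_red x = theta_series x * partition_series"
proof (rule fps_ext)
  fix m
  define N where "N = Suc m"
  have bound: "\<bar>j\<bar> \<le> int (m + 1)" if "triangle j \<le> m" for j
    using abs_le_Suc_triangle[of j] that by linarith
  have "fps_nth (theta_red x) m = fps_nth (fps_const (1 - inverse x) * (\<Prod>n<N. theta_factor x n)) m"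
    by (simp add: theta_red_nth[of m N] N_def)
  also have "\<dots> = (\<Sum>j = - int (Suc N)..int N. fps_nth (jterm x N (Suc N) j) m)"
    by (simp only: finite_triple_product[OF x, symmetric] fps_sum_nth)
  also have "\<dots> = (\<Sum>j | triangle j \<le> m. fps_nth (jterm x N (Suc N) j) m)"
  proof (rule sum.mono_neutral_right)
    show "{j. triangle j \<le> m} \<subseteq> {- int (Suc N)..int N}"
      using bound by (force simp: N_def)
  qed (auto simp: jterm_def[OF x] fps_X_power_mult_nth mult.assoc)
  also have "\<dots> = (\<Sum>j | triangle j \<le> m. (- x) powi j * fps_nth partition_series (m - triangle j))"
  proof (rule sum.cong)
    fix j assume "j \<in> {j. triangle j \<le> m}"
    then have j: "triangle j \<le> m" by simp
    have "m - triangle j \<le> nat (int (Suc N) + j)" "m - triangle j \<le> nat (int N - j)"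
      using abs_le_Suc_triangle[of j] j by (auto simp: N_def)
    then have "fps_nth (qbinom (nat (int (Suc N) + j)) (nat (int N - j)) :: 'a fps) (m - triangle j) =
        fps_nth partition_series (m - triangle j)"
      by (rule qbinom_nth_stable)
    then show "fps_nth (jterm x N (Suc N) j) m =
        (- x) powi j * fps_nth partition_series (m - triangle j)"
      using j bound[OF j] by (auto simp: jterm_def[OF x] fps_X_power_mult_nth N_def)
  qed simp
  also have "{j. triangle j \<le> m} = (\<Union>i\<le>m. {j. triangle j = i})"
    by auto
  also have "sum (\<lambda>j. (- x) powi j * fps_nth partition_series (m - triangle j)) \<dots> =
      (\<Sum>i\<le>m. \<Sum>j | triangle j = i. (- x) powi j * fps_nth partition_series (m - triangle j))"
    by (rule sum.UNION_disjoint) (auto simp: finite_triangle_eq)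
  also have "\<dots> = (\<Sum>i\<le>m. (\<Sum>j | triangle j = i. (- x) powi j) * fps_nth partition_series (m - i))"
    by (simp add: sum_distrib_right)
  also have "\<dots> = fps_nth (theta_series x * partition_series) m"
    by (simp add: theta_series_def qsum_def fps_mult_nth atLeast0AtMost)
  finally show "fps_nth (theta_red x) m = fps_nth (theta_series x * partition_series) m" .
qed

subsection \<open>The addition formula for \<open>\<delta>\<close>\<close>

text \<open>
  Theta functions of nome \<open>q\<^sup>2\<close>. In \<open>\<vartheta>(ab) \<vartheta>(a/b)\<close>, a double sum over \<open>(j, k)\<close>, the substitution
  \<open>j = r + s\<close>, \<open>k = r - s\<close> (if \<open>j + k\<close> is even) or \<open>k = r - s - 1\<close> (if it is odd) separates the
  variables.
\<close>

definition theta_even :: "'a::field \<Rightarrow> 'a fps" where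
  "theta_even x = qsum (\<lambda>s::int. nat (s\<^sup>2)) (\<lambda>s. x powi (2 * s))"

definition theta_odd :: "'a::field \<Rightarrow> 'a fps" where
  "theta_odd x = qsum (\<lambda>r::int. nat (r\<^sup>2 + r)) (\<lambda>r. x powi (2 * r + 1))"

lemma finite_square_eq: "finite {s::int. nat (s\<^sup>2) = m}"
proof (rule finite_subset)
  show "{s::int. nat (s\<^sup>2) = m} \<subseteq> {- int m..int m}"
  proof
    fix s :: int assume "s \<in> {s. nat (s\<^sup>2) = m}"
    then have "s\<^sup>2 = int m" by auto
    moreover have "\<bar>s\<bar> \<le> s\<^sup>2" 
      using mult_left_mono[of 1 "\<bar>s\<bar>" "\<bar>s\<bar>"]
      by (cases "s = 0") (simp_all add: power2_eq_square flip: abs_mult)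
    ultimately show "s \<in> {- int m..int m}" by auto
  qed
qed simp

lemma nat_square_add: "nat (r\<^sup>2 + r) = 2 * triangle r"
  using double_triangle[of r] by (simp add: power2_eq_square algebra_simps)

lemma finite_square_add_eq: "finite {r::int. nat (r\<^sup>2 + r) = m}"
  unfolding nat_square_add by (rule finite_subset[OF _ finite_triangle_eq[of "m div 2"]]) auto

lemma theta_series_mult:
  fixes a b :: "'a::field"
  assumes "a \<noteq> 0" "b \<noteq> 0"
  shows "fps_const a * (theta_series (a * b) * theta_series (a / b)) =
    theta_odd a * theta_even b - theta_odd b * theta_even a"
proof -
  define g where "g = (\<lambda>(r::int, s::int). (r + s, r - s))"
  \<comment> \<open>The pair is taken in the order (s, r) so that, as in \<open>g\<close>, the index
    of the odd series stands first.\<close>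
  define g' where "g' = (\<lambda>(s::int, r::int). (r + s, r - s - 1))"
  define e where "e = (\<lambda>(j, k). triangle j + triangle k)"
  define c where "c = (\<lambda>(j, k). a * ((- (a * b)) powi j * (- (a / b)) powi k))"
  \<comment> \<open>On the images of \<open>g\<close> and \<open>g'\<close> the sum j + k is 2r and
    2r - 1; the leading factor a of the claim turns these exponents into 2r + 1 and 2r.\<close>
  have split: "(a * b) powi j * (a / b) powi k = a powi (j + k) * b powi (j - k)" for j k
    using assms by (simp add: power_int_mult_distrib power_int_divide_distrib power_int_add power_int_diff)
  \<comment> \<open>The sign (-1)^(j+k) is constant on each parity class and produces the minus sign
    of the determinant.\<close>
  have neg: "(- y) powi j * (- z) powi k = (if even (j + k) then y powi j * z powi k else - (y powi j * z powi k))"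
    for y z :: 'a and j k
    by (auto simp: power_int_minus_left)
  have "fps_const a * (theta_series (a * b) * theta_series (a / b)) = qsum e c"
    unfolding theta_series_def qsum_mult[OF finite_triangle_eq finite_triangle_eq] qsum_const_mult
    by (simp add: e_def c_def case_prod_unfold)
  also have "\<dots> = qsum (e \<circ> g) (c \<circ> g) + qsum (e \<circ> g') (c \<circ> g')"
  proof (rule qsum_split)
    show "finite {p. e p = m}" for m
    proof (rule finite_subset)
      show "{p. e p = m} \<subseteq> (\<Union>i\<le>m. {j. triangle j = i}) \<times> (\<Union>i\<le>m. {j. triangle j = i})"
        by (auto simp: e_def)
    qed (auto simp: finite_triangle_eq)
    show "inj g" "inj g'" by (auto simp: g_def g'_def inj_def)
    show "range g \<inter> range g' = {}"
      by (auto simp: g_def g'_def) presburger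
    have "p \<in> range g \<union> range g'" for p
    proof (cases p)
      case (Pair j k)
      show ?thesis
      proof (cases "even (j + k)")
        case True
        then have "p = g ((j + k) div 2, (j - k) div 2)"
          unfolding g_def Pair by simp presburger
        then show ?thesis by blast
      next
        case False
        then have "p = g' ((j - k - 1) div 2, (j + k + 1) div 2)"
          unfolding g'_def Pair by simp presburger
        then show ?thesis by blast
      qed
    qed
    then show "range g \<union> range g' = UNIV" by blast
  qed
  also have "e \<circ> g = (\<lambda>(r, s). nat (r\<^sup>2 + r) + nat (s\<^sup>2))"
  proof -
    have "2 * (int (triangle (r + s)) + int (triangle (r - s))) = 2 * (int (nat (r\<^sup>2 + r)) + int (nat (s\<^sup>2)))" for r s
      unfolding nat_square_add
      by (simp add: distrib_left double_triangle) (simp add: power2_eq_square algebra_simps)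
    then have "triangle (r + s) + triangle (r - s) = nat (r\<^sup>2 + r) + nat (s\<^sup>2)" for r s
      by (metis mult_left_cancel of_nat_add of_nat_eq_iff zero_neq_numeral)
    then show ?thesis by (simp add: fun_eq_iff e_def g_def)
  qed
  also have "c \<circ> g = (\<lambda>(r, s). a powi (2 * r + 1) * b powi (2 * s))"
  proof -
    have "c (g (r, s)) = a powi (2 * r + 1) * b powi (2 * s)" for r s
    proof -
      have "(a * b) powi (r + s) * (a / b) powi (r - s) = a powi (2 * r) * b powi (2 * s)"
        by (simp add: split)
      then show ?thesis using assms by (simp add: c_def g_def neg power_int_add)
    qed
    then show ?thesis by (auto simp: fun_eq_iff)
  qed
  also have "e \<circ> g' = (\<lambda>(s, r). nat (s\<^sup>2 + s) + nat (r\<^sup>2))"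
  proof -
    have "2 * (int (triangle (r + s)) + int (triangle (r - s - 1))) = 2 * (int (nat (s\<^sup>2 + s)) + int (nat (r\<^sup>2)))" for r s
      unfolding nat_square_add
      by (simp add: distrib_left double_triangle) (simp add: power2_eq_square algebra_simps)
    then have "triangle (r + s) + triangle (r - s - 1) = nat (s\<^sup>2 + s) + nat (r\<^sup>2)" for r s
      by (metis mult_left_cancel of_nat_add of_nat_eq_iff zero_neq_numeral)
    then show ?thesis by (simp add: fun_eq_iff e_def g'_def)
  qed
  also have "c \<circ> g' = (\<lambda>(s, r). -1 * (b powi (2 * s + 1) * a powi (2 * r)))"
  proof -
    have "c (g' (s, r)) = - (b powi (2 * s + 1) * a powi (2 * r))" for r s
    proof -
      have "a * ((a * b) powi (r + s) * (a / b) powi (r - s - 1)) = b powi (2 * s + 1) * a powi (2 * r)"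
        using assms power_int_add[of a 1 "2 * r - 1"] by (simp add: split algebra_simps)
      moreover have "odd (r + s + (r - s - 1))" by presburger
      ultimately show ?thesis by (simp only: c_def g'_def prod.case neg if_False mult_minus_right)
    qed
    then show ?thesis by (auto simp: fun_eq_iff)
  qed
  also have "qsum (\<lambda>(r, s). nat (r\<^sup>2 + r) + nat (s\<^sup>2)) (\<lambda>(r, s). a powi (2 * r + 1) * b powi (2 * s)) =
      theta_odd a * theta_even b"
    unfolding theta_odd_def theta_even_def qsum_mult[OF finite_square_add_eq finite_square_eq] ..
  also have "qsum (\<lambda>(s, r). nat (s\<^sup>2 + s) + nat (r\<^sup>2)) (\<lambda>(s, r). -1 * (b powi (2 * s + 1) * a powi (2 * r))) =
      - (theta_odd b * theta_even a)"
    unfolding theta_odd_def theta_even_def qsum_mult[OF finite_square_add_eq finite_square_eq]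
    by (rule fps_ext) (simp add: qsum_def case_prod_unfold sum_negf)
  finally show ?thesis by simp
qed

section \<open>Exactness of the division in \<delta>, and its symmetries\<close>

lemma theta_red_nth_0_nonzero:
  fixes x :: "'a::field"
  assumes "x \<noteq> 1"
  shows "fps_nth (theta_red x) 0 \<noteq> 0"
  using assms inverse_eq_1_iff[of x] by (simp add: theta_red_nth_0)

lemma theta_red_nonzero: "x \<noteq> 1 \<Longrightarrow> theta_red x \<noteq> 0"
  for x :: "'a::field"
  using theta_red_nth_0_nonzero by fastforce

text \<open>The constant coefficients 1 - 1/a and 1 - 1/b are nonzero, so the denominator is a unit
  and the division is exact.\<close>

lemma delta_times_theta:
  fixes a b :: "'a::field_char_0"
  assumes "a \<noteq> 1" "b \<noteq> 1"
  shows "delta a b * (theta_red a * theta_red b) = theta_red (a * b) * theta_deriv_1"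
proof -
  have "fps_nth (theta_red a * theta_red b) 0 \<noteq> 0"
    using assms by (simp add: theta_red_nth_0_nonzero)
  then have "theta_red a * theta_red b dvd 1" by simp
  then show ?thesis
    unfolding delta_def by (simp only: unit_imp_dvd dvd_div_mult_self)
qed

lemma delta_commute: "delta a b = delta b a"
  by (simp add: delta_def mult.commute)

text \<open>Oddness is applied to all three theta values, leaving one sign; the extra factors a, b
  and ab from \<open>theta_red_inverse\<close> cancel.\<close>

lemma delta_inverse_inverse:
  fixes a b :: "'a::field_char_0"
  assumes "a \<noteq> 0" "a \<noteq> 1" "b \<noteq> 0" "b \<noteq> 1"
  shows "delta (inverse a) (inverse b) = - delta a b"
proof -
  let ?c = "fps_const a * fps_const b * (theta_red a * theta_red b)"
  have "delta (inverse a) (inverse b) * ?c =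
      delta (inverse a) (inverse b) * (theta_red (inverse a) * theta_red (inverse b))"
    using assms by (simp add: theta_red_inverse mult_ac)
  also have "\<dots> = theta_red (inverse (a * b)) * theta_deriv_1"
    using assms by (subst delta_times_theta) (auto simp: inverse_eq_1_iff)
  also have "\<dots> = - (fps_const a * fps_const b * (theta_red (a * b) * theta_deriv_1))"
    using assms by (subst theta_red_inverse) (simp_all add: mult_ac)
  also have "\<dots> = - delta a b * ?c"
    unfolding delta_times_theta[OF assms(2,4), symmetric] by (simp add: mult_ac)
  finally show ?thesis
    using assms by (subst (asm) mult_right_cancel) (simp_all add: theta_red_nonzero)
qed

definition theta_det :: "'a::field \<Rightarrow> 'a \<Rightarrow> 'a fps" where
  "theta_det a b = theta_odd a * theta_even b - theta_odd b * theta_even a"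

lemma theta_red_mult:
  fixes a b :: "'a::field"
  assumes "a \<noteq> 0" "b \<noteq> 0"
  shows "fps_const a * (theta_red (a * b) * theta_red (a / b)) =
    partition_series\<^sup>2 * theta_det a b"
  unfolding theta_det_def theta_series_mult[OF assms, symmetric]
  using assms by (simp add: jacobi_triple_product power2_eq_square mult_ac)

text \<open>The case b = 1 of \<open>theta_red_mult\<close>. It turns the denominators of \<delta>
  into minors as well.\<close>

lemma theta_red_square:
  fixes a :: "'a::field"
  assumes "a \<noteq> 0"
  shows "fps_const a * (theta_red a)\<^sup>2 = partition_series\<^sup>2 * theta_det a 1"
  using theta_red_mult[OF assms, of 1] by (simp add: power2_eq_square)

text \<open>
  Up to a factor depending on \<open>a\<close> alone and one depending on \<open>b\<close> alone, \<open>\<delta>(a,b)\<delta>(a,1/b)\<close> is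
  a two by two minor, so that the addition formula below is a Pluecker relation.
\<close>

lemma delta_mult_delta_inverse:
  fixes a b :: "'a::field_char_0"
  assumes "a \<noteq> 0" "a \<noteq> 1" "b \<noteq> 0" "b \<noteq> 1"
  shows "delta a b * delta a (inverse b) * (partition_series\<^sup>2 * theta_det a 1 * theta_det b 1) =
    - (theta_det a b * theta_deriv_1\<^sup>2)"
proof -
  let ?t = "theta_deriv_1 :: 'a fps" and ?P = "partition_series :: 'a fps"
  have b': "inverse b \<noteq> 1" using assms(4) by (simp add: inverse_eq_1_iff)
  \<comment> \<open>A second \<open>?P\<^sup>2\<close> is supplied, one for each of the two minors
    in \<open>theta_red_square\<close>, and cancelled at the end.\<close>
  have "?P\<^sup>2 * (delta a b * delta a (inverse b) * (?P\<^sup>2 * theta_det a 1 * theta_det b 1)) =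
      delta a b * delta a (inverse b) * ((?P\<^sup>2 * theta_det a 1) * (?P\<^sup>2 * theta_det b 1))"
    by (simp add: mult_ac)
  also have "\<dots> = delta a b * delta a (inverse b) *
      ((fps_const a * (theta_red a)\<^sup>2) * (fps_const b * (theta_red b)\<^sup>2))"
    by (simp only: theta_red_square[OF assms(1)] theta_red_square[OF assms(3)])
  also have "\<dots> = - (fps_const a * ((delta a b * (theta_red a * theta_red b)) *
      (delta a (inverse b) * (theta_red a * theta_red (inverse b)))))"
    using assms by (simp add: theta_red_inverse power2_eq_square mult_ac)
  also have "\<dots> = - (fps_const a * (theta_red (a * b) * theta_red (a / b)) * ?t\<^sup>2)"
    unfolding delta_times_theta[OF assms(2,4)] delta_times_theta[OF assms(2) b']
    by (simp add: power2_eq_square divide_inverse mult_ac)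
  also have "\<dots> = ?P\<^sup>2 * - (theta_det a b * ?t\<^sup>2)"
    unfolding theta_red_mult[OF assms(1,3)] by simp
  finally show ?thesis
    by (subst (asm) mult_left_cancel) (simp_all add: partition_series_nonzero)
qed

lemma delta_addition:
  fixes a b c :: "'a::field_char_0"
  assumes "a \<noteq> 0" "a \<noteq> 1" "b \<noteq> 0" "b \<noteq> 1" "c \<noteq> 0" "c \<noteq> 1"
  shows "delta a b * delta a (inverse b) + delta c a * delta c (inverse a) =
    delta c b * delta c (inverse b)"
proof -
  let ?t = "theta_deriv_1 :: 'a fps" and ?P = "partition_series :: 'a fps"
  let ?D = "\<lambda>x. theta_det x 1 :: 'a fps"
  define X where "X = delta a b * delta a (inverse b)"
  define Y where "Y = delta c a * delta c (inverse a)"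
  define Z where "Z = delta c b * delta c (inverse b)"
  \<comment> \<open>By \<open>theta_red_square\<close> the minor is, up to the factor
    \<open>?P\<^sup>2\<close>, a nonzero multiple of a nonzero square; this permits the final
    cancellation.\<close>
  have D: "?D x \<noteq> 0" if "x \<noteq> 0" "x \<noteq> 1" for x
    using theta_red_square[OF that(1)] theta_red_nonzero[OF that(2)] that(1) by auto
  have X: "X * (?P\<^sup>2 * ?D a * ?D b) = - (theta_det a b * ?t\<^sup>2)"
    and Y: "Y * (?P\<^sup>2 * ?D c * ?D a) = - (theta_det c a * ?t\<^sup>2)"
    and Z: "Z * (?P\<^sup>2 * ?D c * ?D b) = - (theta_det c b * ?t\<^sup>2)"
    unfolding X_def Y_def Z_def using assms by (simp_all only: delta_mult_delta_inverse not_False_eq_True)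
  have "(X + Y) * (?P\<^sup>2 * ?D a * ?D b * ?D c) =
      X * (?P\<^sup>2 * ?D a * ?D b) * ?D c + Y * (?P\<^sup>2 * ?D c * ?D a) * ?D b"
    by (simp add: algebra_simps)
  also have "\<dots> = - (theta_det a b * ?D c + theta_det c a * ?D b) * ?t\<^sup>2"
    unfolding X Y by (simp add: algebra_simps)
  \<comment> \<open>The three-term Pluecker relation for the columns
    \<open>(theta_odd x, theta_even x)\<close> at x = a, b, c, 1.\<close>
  also have "theta_det a b * ?D c + theta_det c a * ?D b = theta_det c b * ?D a"
    by (simp add: theta_det_def algebra_simps)
  also have "- (theta_det c b * ?D a) * ?t\<^sup>2 = (Z * (?P\<^sup>2 * ?D c * ?D b)) * ?D a"
    unfolding Z by (simp add: algebra_simps)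
  also have "\<dots> = Z * (?P\<^sup>2 * ?D a * ?D b * ?D c)"
    by (simp add: mult_ac)
  finally have "X + Y = Z"
    using assms by (subst (asm) mult_right_cancel) (simp_all add: D partition_series_nonzero)
  then show ?thesis by (simp only: X_def Y_def Z_def)
qed

text \<open>Integers are related to themselves by every \<open>field_relation\<close>, so this makes
  \<open>theta_deriv_1\<close> compatible with base change.\<close>

lemma theta_deriv_1_Ints: "fps_nth (theta_deriv_1 :: 'a::field_char_0 fps) n \<in> \<int>"
proof -
  \<comment> \<open>\<open>\<vartheta>\<close> has a simple zero at \<open>1\<close>, so its derivative there is the product at \<open>\<epsilon> = 0\<close>.\<close>
  define r where "r = (fps_binomial (1/2) :: 'a fps)"
  \<comment> \<open>The series whose coefficients are integral at \<epsilon> = 0 form a subring. It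
    contains the factors because 1 + \<epsilon> and its inverse have constant term 1.\<close>
  define I where "I = {f :: 'a fps fps. \<forall>m. fps_nth (fps_nth f m) 0 \<in> \<int>}"
  have I_mult: "f * g \<in> I" and I_diff: "f - g \<in> I" if "f \<in> I" "g \<in> I" for f g
    using that by (auto simp: I_def fps_mult_nth fps_sum_nth intro!: Ints_sum Ints_mult Ints_diff)
  have I_1: "1 \<in> I" and I_X: "fps_X ^ k * fps_const c \<in> I" if "fps_nth c 0 \<in> \<int>" for k c
    using that by (auto simp: I_def fps_X_power_mult_nth)
  have "theta_factor (1 + fps_X) k \<in> I" for k
    unfolding theta_factor_def by (intro I_mult I_diff I_1[of 0] I_X) auto
  then have "(\<Prod>k<n. theta_factor (1 + fps_X) k) \<in> I"
    by (induction n) (auto intro!: I_mult I_1[of 0])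
  then have int: "fps_nth (fps_nth (\<Prod>k<n. theta_factor (1 + fps_X :: 'a fps) k) n) 0 \<in> \<int>"
    by (simp add: I_def)
  have "fps_nth (theta r) n =
      r * (1 - inverse (1 + fps_X)) * fps_nth (\<Prod>k<n. theta_factor (1 + fps_X) k) n"
    unfolding theta_def r_def fps_binomial_half_square
    by (simp add: theta_red_nth[OF order.refl] mult.assoc)
  then have "fps_nth (theta_deriv_1 :: 'a fps) n =
      fps_nth (fps_nth (\<Prod>k<n. theta_factor (1 + fps_X :: 'a fps) k) n) 0"
    unfolding theta_deriv_1_def r_def[symmetric]
    by (simp add: fps_mult_nth fps_inverse_fps_X_plus1 r_def)
  then show ?thesis using int by simp
qed

subsection \<open>Base change of \<open>\<delta>\<close>\<close>

text \<open>
  Applied to the graph of an endomorphism of the field, and to the identity of a subfield.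
\<close>

locale field_relation =
  fixes R :: "'a::field_char_0 \<Rightarrow> 'a \<Rightarrow> bool"
  assumes R_1: "R 1 1"
    and R_diff: "R x x' \<Longrightarrow> R y y' \<Longrightarrow> R (x - y) (x' - y')"
    and R_mult: "R x x' \<Longrightarrow> R y y' \<Longrightarrow> R (x * y) (x' * y')"
    and R_inverse: "R x x' \<Longrightarrow> R (inverse x) (inverse x')"
begin

lemma R_0: "R 0 0"
  using R_diff[OF R_1 R_1] by simp

lemma R_uminus: "R x x' \<Longrightarrow> R (- x) (- x')"
  using R_diff[OF R_0] by simp

lemma R_add: "R x x' \<Longrightarrow> R y y' \<Longrightarrow> R (x + y) (x' + y')"
  using R_diff[of x x' "- y" "- y'"] R_uminus by simp

lemma R_sum: "(\<And>i. i \<in> A \<Longrightarrow> R (f i) (g i)) \<Longrightarrow> R (sum f A) (sum g A)"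
  by (induction A rule: infinite_finite_induct) (auto intro: R_0 R_add)

lemma R_of_nat: "R (of_nat n) (of_nat n)"
  by (induction n) (auto intro: R_0 R_1 R_add)

lemma R_Ints: "x \<in> \<int> \<Longrightarrow> R x x"
  by (elim Ints_cases, rename_tac z, case_tac z rule: int_cases2) (auto intro: R_of_nat R_uminus)

definition fps_R :: "'a fps \<Rightarrow> 'a fps \<Rightarrow> bool" where
  "fps_R f g \<longleftrightarrow> (\<forall>n. R (fps_nth f n) (fps_nth g n))"

lemma fps_R_1: "fps_R 1 1"
  by (simp add: fps_R_def R_0 R_1)

lemma fps_R_diff: "fps_R f f' \<Longrightarrow> fps_R g g' \<Longrightarrow> fps_R (f - g) (f' - g')"
  by (simp add: fps_R_def R_diff)

lemma fps_R_mult: "fps_R f f' \<Longrightarrow> fps_R g g' \<Longrightarrow> fps_R (f * g) (f' * g')"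
  by (simp add: fps_R_def fps_mult_nth R_mult R_sum)

lemma fps_R_inverse:
  assumes "fps_R f f'"
  shows "fps_R (inverse f) (inverse f')"
  unfolding fps_R_def
proof
  fix n
  show "R (fps_nth (inverse f) n) (fps_nth (inverse f') n)"
  proof (induction n rule: less_induct)
    case (less n)
    \<comment> \<open>The recursion behind g * inverse g = 1: each coefficient is a rational
      expression in g and in earlier coefficients of the inverse.\<close>
    have "fps_nth (inverse g) n = (if n = 0 then inverse (fps_nth g 0) else
        - (inverse (fps_nth g 0) * (\<Sum>i=1..n. fps_nth g i * fps_nth (inverse g) (n - i))))" for g :: "'a fps"
      by (cases n) (simp_all add: fps_inverse_def)
    then show ?case
      using assms less by (auto simp: fps_R_def intro!: R_inverse R_uminus R_mult R_sum)
  qed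
qed

lemma fps_R_theta_factor: "R x x' \<Longrightarrow> fps_R (theta_factor x n) (theta_factor x' n)"
proof -
  have *: "fps_R (1 - fps_X ^ k * fps_const c) (1 - fps_X ^ k * fps_const c')" if "R c c'" for k c c'
    using that by (intro fps_R_diff fps_R_1) (auto simp: fps_R_def fps_X_power_mult_nth R_0)
  show "R x x' \<Longrightarrow> ?thesis"
    unfolding theta_factor_def by (intro fps_R_mult * R_inverse)
qed

lemma fps_R_theta_red:
  assumes "R x x'"
  shows "fps_R (theta_red x) (theta_red x')"
proof -
  have "fps_R (\<Prod>k<n. theta_factor x k) (\<Prod>k<n. theta_factor x' k)" for n
    by (induction n) (auto intro!: fps_R_1 fps_R_mult fps_R_theta_factor assms)
  then show ?thesis
    unfolding fps_R_def using assms by (auto simp: theta_red_nth[OF order.refl] intro!: R_mult R_diff R_1 R_inverse)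
qed

text \<open>The coefficients of \<delta> are built from a and b by field operations and integers.
  Arguments different from 1 allow the division to be replaced by multiplication with an inverse
  series.\<close>

lemma fps_R_delta:
  assumes "R a a'" "R b b'" "a \<noteq> 1" "a' \<noteq> 1" "b \<noteq> 1" "b' \<noteq> 1"
  shows "fps_R (delta a b) (delta a' b')"
proof -
  have *: "delta x y = theta_red (x * y) * theta_deriv_1 * inverse (theta_red x * theta_red y)"
    if "x \<noteq> 1" "y \<noteq> 1" for x y :: 'a
    using that unfolding delta_def by (subst fps_divide_unit) (simp_all add: theta_red_nth_0_nonzero)
  have "fps_R theta_deriv_1 theta_deriv_1"
    by (simp add: fps_R_def R_Ints theta_deriv_1_Ints)
  then show ?thesis
    using assms by (simp only: * not_False_eq_True) (intro fps_R_mult fps_R_inverse fps_R_theta_red R_mult)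
qed

end

section \<open>Characters in the fraction field, and the two relations used for base change\<close>

lemma character_0: "character 0 = 1"
  by (simp add: character_def One_fract_def)

lemma character_add: "character (v + w) = character v * character w"
  by (simp add: character_def Poly_Mapping.mult_single)

lemma character_nonzero: "character w \<noteq> 0"
  using character_add[of w "- w"] by (auto simp: character_0)

lemma character_uminus: "character (- w) = inverse (character w)"
  using character_add[of w "- w"] by (simp add: character_0 field_simps character_nonzero)

lemma character_eq_1_iff: "character w = 1 \<longleftrightarrow> w = 0"
proof
  assume "character w = 1"
  then have "Poly_Mapping.single w (1::int) = Poly_Mapping.single 0 1"
    by (simp add: character_def One_fract_def eq_fract)
  then have "Poly_Mapping.lookup (Poly_Mapping.single w (1::int)) w = Poly_Mapping.lookup (Poly_Mapping.single 0 1) w"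
    by simp
  then show "w = 0" by (simp add: lookup_single lookup_one when_def split: if_splits)
qed (simp add: character_0)

lemma ratfun_subst_character:
  assumes "\<And>v w. g (v + w) = g v + g w" "inj g"
  shows "ratfun_subst g (character w) = character (g w)"
proof -
  have "g 0 = 0" using assms(1)[of 0 0] by simp
  then show ?thesis
    using assms laurent_subst_single[of g 0 1] unfolding character_def
    by (subst ratfun_subst_Fract) (auto simp: laurent_subst_single)
qed

context
  fixes g :: "'n::linorder weight \<Rightarrow> 'n weight"
  assumes g_add: "\<And>v w. g (v + w) = g v + g w" and g_inj: "inj g"
begin

lemma ratfun_subst_add: "ratfun_subst g (y + z) = ratfun_subst g y + ratfun_subst g z"
  by (cases y, cases z)
    (simp add: ratfun_subst_Fract[OF g_add g_inj] laurent_subst_add laurent_subst_mult[OF g_add]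
      laurent_subst_eq_0_iff[OF g_inj])

lemma ratfun_subst_mult: "ratfun_subst g (y * z) = ratfun_subst g y * ratfun_subst g z"
  by (cases y, cases z)
    (simp add: ratfun_subst_Fract[OF g_add g_inj] laurent_subst_mult[OF g_add])

lemma ratfun_subst_0: "ratfun_subst g 0 = 0"
  using ratfun_subst_add[of 0 0] by simp

lemma ratfun_subst_1: "ratfun_subst g 1 = 1"
  using ratfun_subst_character[OF g_add g_inj, of 0] g_add[of 0 0] by (simp add: character_0)

lemma ratfun_subst_diff: "ratfun_subst g (y - z) = ratfun_subst g y - ratfun_subst g z"
  using ratfun_subst_add[of "y - z" z] by simp

lemma ratfun_subst_inverse: "ratfun_subst g (inverse z) = inverse (ratfun_subst g z)"
proof (cases "z = 0")
  case False
  then show ?thesis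
    using ratfun_subst_mult[of z "inverse z"] by (intro inverse_unique[symmetric]) (simp add: ratfun_subst_1)
qed (simp add: ratfun_subst_0)

lemma field_relation_ratfun_subst: "field_relation (\<lambda>y z. z = ratfun_subst g y)"
  by unfold_locales
    (simp_all add: ratfun_subst_1 ratfun_subst_diff ratfun_subst_mult ratfun_subst_inverse)

end

text \<open>The functions of \<lambda> and h form a subfield. For equality restricted to it,
  \<open>fps_R f f\<close> says that all coefficients of f lie there, which is how \<kappa> is
  handled.\<close>

lemma field_relation_lambda_h:
  "field_relation (\<lambda>y z :: 'n::linorder ratfun. y = z \<and> y \<in> lambda_h_functions)"
proof -
  define L :: "'n laurent set" where
    "L = {p. \<forall>w\<in>Poly_Mapping.keys p. torus_part w = 0}"
  have S: "lambda_h_functions = {Fract p r | p r. r \<noteq> 0 \<and> p \<in> L \<and> r \<in> L}"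
    by (auto simp: lambda_h_functions_def L_def)
  have L1: "1 \<in> L" by (simp add: L_def zero_weight_def)
  have L_mult: "p * r \<in> L" if "p \<in> L" "r \<in> L" for p r
    using that keys_mult[of p r] by (fastforce simp: L_def plus_weight_def)
  have L_diff: "p - r \<in> L" if "p \<in> L" "r \<in> L" for p r
    using that by (auto simp: L_def in_keys_iff lookup_minus)
  have SI: "Fract p r \<in> lambda_h_functions" if "r \<noteq> 0" "p \<in> L" "r \<in> L" for p r
    using that S by blast
  have inverse: "inverse y \<in> lambda_h_functions" if "y \<in> lambda_h_functions" for y :: "'n ratfun"
  proof -
    obtain p r where pr: "y = Fract p r" "r \<noteq> 0" "p \<in> L" "r \<in> L" using \<open>y \<in> _\<close> S by blast
    show ?thesis
    proof (cases "p = 0")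
      \<comment> \<open>Swapping numerator and denominator would give denominator 0; the inverse of
        0 is 0, written as 0/1.\<close>
      case True
      then show ?thesis using SI[of 1 0] L1 L_diff[OF L1 L1] pr by (simp add: fract_collapse)
    qed (use pr SI in simp)
  qed
  have op: "y - z \<in> lambda_h_functions \<and> y * z \<in> lambda_h_functions"
    if "y \<in> lambda_h_functions" "z \<in> lambda_h_functions" for y z :: "'n ratfun"
  proof -
    obtain p r where "y = Fract p r" "r \<noteq> 0" "p \<in> L" "r \<in> L" using \<open>y \<in> _\<close> S by blast
    moreover obtain p' r' where "z = Fract p' r'" "r' \<noteq> 0" "p' \<in> L" "r' \<in> L" using \<open>z \<in> _\<close> S by blast
    ultimately show ?thesis by (simp add: SI L_mult L_diff)
  qed
  show ?thesis
    by unfold_locales (use SI[of 1 1] L1 op inverse in \<open>auto simp: One_fract_def\<close>)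
qed

lemma character_lambda_h: "torus_part w = 0 \<Longrightarrow> character w \<in> lambda_h_functions"
  unfolding lambda_h_functions_def character_def
  by (intro CollectI exI[of _ "Poly_Mapping.single w 1"] exI[of _ 1]) (auto simp: zero_weight_def)

subsection \<open>Reflections and the Weyl group\<close>

lemma pairing_add_left: "pairing (x + y) z = pairing x z + pairing y z"
  by (simp add: pairing_def lookup_add sum.distrib distrib_right)

lemma pairing_add_right: "pairing x (y + z) = pairing x y + pairing x z"
  by (simp add: pairing_def lookup_add sum.distrib distrib_left)

lemma pairing_cmul_left: "pairing (frag_cmul c x) y = c * pairing x y"
  by (simp add: pairing_def sum_distrib_left mult.assoc)

lemma pairing_cmul_right: "pairing x (frag_cmul c y) = c * pairing x y"
  by (simp add: pairing_def sum_distrib_left mult_ac)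

lemma pairing_diff_left: "pairing (x - y) z = pairing x z - pairing y z"
  using pairing_add_left[of "x - y" y z] by simp

lemma pairing_diff_right: "pairing x (y - z) = pairing x y - pairing x z"
  using pairing_add_right[of x "y - z" z] by simp

lemma reflection_add: "reflection \<alpha> \<alpha>v (x + y) = reflection \<alpha> \<alpha>v x + reflection \<alpha> \<alpha>v y"
  by (simp add: reflection_def pairing_add_left frag_cmul_distrib)

lemma coreflection_add: "coreflection \<alpha> \<alpha>v (x + y) = coreflection \<alpha> \<alpha>v x + coreflection \<alpha> \<alpha>v y"
  by (simp add: coreflection_def pairing_add_right frag_cmul_distrib)

lemma frag_cmul_2: "frag_cmul 2 x = x + x"
  using frag_cmul_distrib[of 1 1 x] by simp

context
  fixes \<alpha> \<alpha>v :: "'n::finite lattice"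
  assumes pairing2: "pairing \<alpha> \<alpha>v = 2"
begin

lemma reflection_root: "reflection \<alpha> \<alpha>v \<alpha> = - \<alpha>"
  unfolding reflection_def pairing2 frag_cmul_2 by simp

lemma coreflection_coroot: "coreflection \<alpha> \<alpha>v \<alpha>v = - \<alpha>v"
  unfolding coreflection_def pairing2 frag_cmul_2 by simp

lemma reflection_involution: "reflection \<alpha> \<alpha>v (reflection \<alpha> \<alpha>v x) = x"
proof -
  have "pairing (reflection \<alpha> \<alpha>v x) \<alpha>v = - pairing x \<alpha>v"
    by (simp add: reflection_def pairing_diff_left pairing_cmul_left pairing2)
  then show ?thesis
    unfolding reflection_def[of _ _ "reflection \<alpha> \<alpha>v x"]
    by (simp only: flip: minus_frag_cmul) (simp add: reflection_def del: minus_frag_cmul)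
qed

lemma coreflection_involution: "coreflection \<alpha> \<alpha>v (coreflection \<alpha> \<alpha>v y) = y"
proof -
  have "pairing \<alpha> (coreflection \<alpha> \<alpha>v y) = - pairing \<alpha> y"
    by (simp add: coreflection_def pairing_diff_right pairing_cmul_right pairing2)
  then show ?thesis
    unfolding coreflection_def[of _ _ "coreflection \<alpha> \<alpha>v y"]
    by (simp only: flip: minus_frag_cmul) (simp add: coreflection_def del: minus_frag_cmul)
qed

lemma lambda_reflect_weight_add:
  "lambda_reflect_weight \<alpha> \<alpha>v (v + w) = lambda_reflect_weight \<alpha> \<alpha>v v + lambda_reflect_weight \<alpha> \<alpha>v w"
  by (simp add: lambda_reflect_weight_def plus_weight_def coreflection_add)

lemma lambda_reflect_weight_involution:
  "lambda_reflect_weight \<alpha> \<alpha>v (lambda_reflect_weight \<alpha> \<alpha>v w) = w"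
  by (simp add: lambda_reflect_weight_def coreflection_involution)

lemma inj_lambda_reflect_weight: "inj (lambda_reflect_weight \<alpha> \<alpha>v)"
  by (metis injI lambda_reflect_weight_involution)

end

section \<open>The reflection acting on functions of \<lambda>\<close>

lemma laurent_subst_involution:
  assumes "\<And>w. g (g w) = w"
  shows "laurent_subst g (laurent_subst g p) = p"
proof -
  have "laurent_subst g (laurent_subst g p) =
      (\<Sum>w\<in>Poly_Mapping.keys p. Poly_Mapping.single (g (g w)) (Poly_Mapping.lookup p w))"
    unfolding laurent_subst_def[of g p] by (simp only: laurent_subst_sum laurent_subst_single)
  then show ?thesis by (simp add: assms laurent_sum_monomials)
qed

lemma ratfun_subst_involution:
  assumes "\<And>v w. g (v + w) = g v + g w" "\<And>w. g (g w) = w"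
  shows "ratfun_subst g (ratfun_subst g z) = z"
proof -
  have "inj g" by (metis injI assms(2))
  then show ?thesis
    using assms by (cases z) (simp add: ratfun_subst_Fract laurent_subst_eq_0_iff laurent_subst_involution)
qed

context
  fixes \<alpha> \<alpha>v :: "'n::{finite,linorder} lattice"
  assumes pairing2: "pairing \<alpha> \<alpha>v = 2"
begin

lemmas reflect_weight =
  lambda_reflect_weight_add[OF pairing2] inj_lambda_reflect_weight[OF pairing2]

lemma lambda_reflect_add:
  "lambda_reflect \<alpha> \<alpha>v (f + g) = lambda_reflect \<alpha> \<alpha>v f + lambda_reflect \<alpha> \<alpha>v g"
  by (rule fps_ext) (simp add: lambda_reflect_def ratfun_subst_add[OF reflect_weight])

lemma lambda_reflect_mult:
  "lambda_reflect \<alpha> \<alpha>v (f * g) = lambda_reflect \<alpha> \<alpha>v f * lambda_reflect \<alpha> \<alpha>v g"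
proof (rule fps_ext)
  have sum: "ratfun_subst (lambda_reflect_weight \<alpha> \<alpha>v) (sum F A) =
      (\<Sum>i\<in>A. ratfun_subst (lambda_reflect_weight \<alpha> \<alpha>v) (F i))" for F and A :: "nat set"
    by (induction A rule: infinite_finite_induct)
      (simp_all add: ratfun_subst_0[OF reflect_weight] ratfun_subst_add[OF reflect_weight])
  show "fps_nth (lambda_reflect \<alpha> \<alpha>v (f * g)) m =
      fps_nth (lambda_reflect \<alpha> \<alpha>v f * lambda_reflect \<alpha> \<alpha>v g) m" for m
    by (simp add: lambda_reflect_def fps_mult_nth sum ratfun_subst_mult[OF reflect_weight])
qed

lemma lambda_reflect_involution: "lambda_reflect \<alpha> \<alpha>v (lambda_reflect \<alpha> \<alpha>v f) = f"
  by (rule fps_ext)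
    (simp add: lambda_reflect_def ratfun_subst_involution lambda_reflect_weight_add[OF pairing2]
      lambda_reflect_weight_involution[OF pairing2])

text \<open>Base change along the graph of the reflection; injectivity keeps nonzero weights
  nonzero, so the arguments of \<delta> stay different from 1.\<close>

lemma lambda_reflect_delta:
  assumes "v \<noteq> 0" "w \<noteq> 0"
  shows "lambda_reflect \<alpha> \<alpha>v (delta (character v) (character w)) =
    delta (character (lambda_reflect_weight \<alpha> \<alpha>v v)) (character (lambda_reflect_weight \<alpha> \<alpha>v w))"
proof -
  let ?g = "lambda_reflect_weight \<alpha> \<alpha>v"
  interpret field_relation "\<lambda>y z. z = ratfun_subst ?g y"
    by (rule field_relation_ratfun_subst[OF reflect_weight])
  have "?g 0 = 0"
    using lambda_reflect_weight_add[OF pairing2, of 0 0] by simp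
  then have "?g u \<noteq> 0" if "u \<noteq> 0" for u
    using that inj_eq[OF reflect_weight(2), of u 0] by simp
  then have "fps_R (delta (character v) (character w)) (delta (character (?g v)) (character (?g w)))"
    using assms
    by (intro fps_R_delta) (simp_all add: ratfun_subst_character[OF reflect_weight] character_eq_1_iff)
  then show ?thesis
    by (intro fps_ext) (simp add: fps_R_def lambda_reflect_def)
qed

end

section \<open>The Weyl group and the characters of the line bundle\<close>

context based_root_datum
begin

lemma weyl_group_add: "\<sigma> \<in> weyl_group \<Phi> coroot \<Longrightarrow> \<sigma> (x + y) = \<sigma> x + \<sigma> y"
  by (induction rule: weyl_group.induct) (simp_all add: reflection_add)

lemma weyl_group_0: "\<sigma> \<in> weyl_group \<Phi> coroot \<Longrightarrow> \<sigma> 0 = 0"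
  using weyl_group_add[of \<sigma> 0 0] by simp

lemma weyl_group_uminus: "\<sigma> \<in> weyl_group \<Phi> coroot \<Longrightarrow> \<sigma> (- x) = - \<sigma> x"
  using weyl_group_add[of \<sigma> x "- x"] weyl_group_0[of \<sigma>] by (simp add: eq_neg_iff_add_eq_0 add.commute)

lemma weyl_group_inj: "\<sigma> \<in> weyl_group \<Phi> coroot \<Longrightarrow> inj \<sigma>"
proof (induction rule: weyl_group.induct)
  case (step \<sigma> \<alpha>)
  have "inj (reflection \<alpha> (coroot \<alpha>))"
    by (metis injI reflection_involution[OF pairing_coroot[OF step.hyps(2)]])
  then show ?case using step.IH by (rule inj_compose)
qed simp

text \<open>\<open>weyl_group\<close> grows by composition on the left, while \<open>C_op\<close>
  composes on the right; by associativity the induction leaves the right factor untouched.\<close>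

lemma weyl_group_right:
  assumes "\<sigma> \<in> weyl_group \<Phi> coroot" "\<alpha> \<in> \<Phi>"
  shows "\<sigma> \<circ> reflection \<alpha> (coroot \<alpha>) \<in> weyl_group \<Phi> coroot"
  using assms(1)
proof (induction rule: weyl_group.induct)
  case id
  show ?case using weyl_group.step[OF weyl_group.id assms(2)] by simp
next
  case (step \<sigma> \<beta>)
  show ?case using weyl_group.step[OF step.IH step.hyps(2)] by (simp only: comp_assoc)
qed

end

text \<open>The reflection sends \<alpha> to its negative, and \<sigma> is additive.\<close>

lemma line_char_reflection:
  fixes \<alpha> :: "'n::{finite,linorder} lattice"
  assumes "based_root_datum \<Phi> coroot \<Delta>" "\<sigma> \<in> weyl_group \<Phi> coroot" "\<alpha> \<in> \<Phi>"
  shows "line_char \<alpha> (\<sigma> \<circ> reflection \<alpha> (coroot \<alpha>)) = inverse (line_char \<alpha> \<sigma>)"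
proof -
  interpret based_root_datum \<Phi> coroot \<Delta> by fact
  show ?thesis
    unfolding line_char_def character_uminus[symmetric]
    by (simp add: reflection_root[OF pairing_coroot[OF assms(3)]] weyl_group_uminus[OF assms(2)]
        uminus_weight_def)
qed

section \<open>The square of the operator\<close>

theorem theorem5p1:
  fixes \<Phi> :: "'n::{finite,linorder} lattice set"
    and coroot :: "'n lattice \<Rightarrow> 'n lattice"
    and \<Delta> :: "'n lattice set"
    and \<alpha> :: "'n lattice"
  assumes "based_root_datum \<Phi> coroot \<Delta>"
    and "simply_connected_semisimple \<Phi> coroot \<or> general_linear \<Phi> coroot \<Delta>"
    and "\<alpha> \<in> \<Delta>"
  shows "(\<forall>f \<in> weyl_group \<Phi> coroot \<rightarrow>\<^sub>E UNIV.
            (C_op \<Phi> coroot \<alpha> \<circ> C_op \<Phi> coroot \<alpha>) f =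
            (\<lambda>\<sigma>\<in>weyl_group \<Phi> coroot. kappa (coroot \<alpha>) * f \<sigma>)) \<and>
         (\<forall>m. fps_nth (kappa (coroot \<alpha>)) m \<in> lambda_h_functions)"
proof -
  interpret based_root_datum \<Phi> coroot \<Delta> by fact
  define W where "W = weyl_group \<Phi> coroot"
  define s where "s = reflection \<alpha> (coroot \<alpha>)"
  define h where "h = (coord_h :: 'n ratfun)"
  define \<nu> where "\<nu> = nu (coroot \<alpha>)"
  define rf where "rf = lambda_reflect \<alpha> (coroot \<alpha>)"
  have \<alpha>: "\<alpha> \<in> \<Phi>" using assms(3) simple_roots by blast
  note pairing2 = pairing_coroot[OF \<alpha>]
  \<comment> \<open>The pairing 2 excludes zero vectors. Hence \<nu>, and later L, are nontrivial
    characters, as the exact division in \<delta> requires.\<close>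
  have nonzero: "\<alpha> \<noteq> 0" "coroot \<alpha> \<noteq> 0"
    using pairing2 by (auto simp: pairing_def)
  have weight: "Weight 0 0 1 \<noteq> (0 :: 'n weight)" "Weight 0 (coroot \<alpha>) 0 \<noteq> (0 :: 'n weight)"
    using nonzero by (simp_all add: zero_weight_def)
  have h: "h \<noteq> 0" "h \<noteq> 1" and \<nu>: "\<nu> \<noteq> 0" "\<nu> \<noteq> 1"
    using weight by (simp_all add: h_def coord_h_def \<nu>_def nu_def character_nonzero character_eq_1_iff)
  have s: "\<sigma> \<circ> s \<circ> s = \<sigma>" for \<sigma>
    by (simp add: fun_eq_iff s_def reflection_involution[OF pairing2])
  have C: "C_op \<Phi> coroot \<alpha> f \<sigma> = delta (line_char \<alpha> \<sigma>) \<nu> * rf (f \<sigma>) +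
      delta (line_char \<alpha> \<sigma>) h * rf (f (\<sigma> \<circ> s))" if "\<sigma> \<in> W" for f \<sigma>
    using that by (simp add: C_op_def W_def s_def h_def \<nu>_def rf_def)
  have "C_op \<Phi> coroot \<alpha> (C_op \<Phi> coroot \<alpha> f) \<sigma> = kappa (coroot \<alpha>) * f \<sigma>"
    if \<sigma>: "\<sigma> \<in> W" for f \<sigma>
  proof -
    define L where "L = line_char \<alpha> \<sigma>"
    have "\<sigma> \<alpha> \<noteq> 0"
      using \<sigma> nonzero(1) weyl_group_0[of \<sigma>] inj_eq[OF weyl_group_inj[of \<sigma>], of \<alpha> 0]
      by (auto simp: W_def)
    then have weight_L: "Weight (- \<sigma> \<alpha>) 0 0 \<noteq> 0" by (simp add: zero_weight_def)
    then have L: "L \<noteq> 0" "L \<noteq> 1"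
      by (simp_all add: L_def line_char_def character_nonzero character_eq_1_iff)
    have \<sigma>s: "\<sigma> \<circ> s \<in> W"
      using weyl_group_right[OF _ \<alpha>] \<sigma> by (simp add: W_def s_def)
    have Ls: "line_char \<alpha> (\<sigma> \<circ> s) = inverse L"
      using line_char_reflection[OF assms(1) _ \<alpha>] \<sigma> by (simp add: W_def s_def L_def)
    have neg: "inverse (character w) = character (- w)" for w :: "'n weight"
      by (simp add: character_uminus)
    have coreflection_0: "coreflection \<alpha> (coroot \<alpha>) 0 = 0"
      using coreflection_add[of \<alpha> "coroot \<alpha>" 0 0] by simp
    \<comment> \<open>The reflection fixes the weights of L and h and negates the coroot, so only
      \<nu> gets inverted.\<close>
    have rf: "rf (delta L \<nu>) = delta L (inverse \<nu>)" "rf (delta L h) = delta L h"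
      "rf (delta (inverse L) \<nu>) = delta (inverse L) (inverse \<nu>)"
      "rf (delta (inverse L) h) = delta (inverse L) h"
      unfolding L_def line_char_def \<nu>_def nu_def h_def coord_h_def rf_def neg
      using weight weight_L
      by (simp_all add: lambda_reflect_delta[OF pairing2])
        (simp_all add: lambda_reflect_weight_def uminus_weight_def coreflection_0
          coreflection_coroot[OF pairing2])
    have "C_op \<Phi> coroot \<alpha> (C_op \<Phi> coroot \<alpha> f) \<sigma> =
        delta L \<nu> * rf (delta L \<nu> * rf (f \<sigma>) + delta L h * rf (f (\<sigma> \<circ> s))) +
        delta L h * rf (delta (inverse L) \<nu> * rf (f (\<sigma> \<circ> s)) + delta (inverse L) h * rf (f \<sigma>))"
      by (simp only: C[OF \<sigma>] C[OF \<sigma>s] Ls s L_def[symmetric])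
    also have "\<dots> =
        delta L \<nu> * (delta L (inverse \<nu>) * f \<sigma> + delta L h * f (\<sigma> \<circ> s)) +
        delta L h * (delta (inverse L) (inverse \<nu>) * f (\<sigma> \<circ> s) + delta (inverse L) h * f \<sigma>)"
      using rf unfolding rf_def
      by (simp add: lambda_reflect_add[OF pairing2] lambda_reflect_mult[OF pairing2]
          lambda_reflect_involution[OF pairing2])
    \<comment> \<open>The coefficient of f at \<open>\<sigma> \<circ> s\<close> vanishes, since
      \<open>delta (inverse L) (inverse \<nu>) = - delta L \<nu>\<close>.\<close>
    also have "\<dots> = (delta L \<nu> * delta L (inverse \<nu>) + delta L h * delta (inverse L) h) * f \<sigma>"
      unfolding delta_inverse_inverse[OF L \<nu>] by (simp add: algebra_simps)
    also have "delta L h * delta (inverse L) h = delta h L * delta h (inverse L)"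
      by (simp only: delta_commute)
    \<comment> \<open>The addition formula at a = L, b = \<nu>, c = h; the dependence on L, hence on
      \<sigma>, disappears here.\<close>
    also have "delta L \<nu> * delta L (inverse \<nu>) + \<dots> = kappa (coroot \<alpha>)"
      unfolding delta_addition[OF L \<nu> h] by (simp add: kappa_def h_def \<nu>_def inverse_eq_divide)
    finally show ?thesis .
  qed
  \<comment> \<open>Outside the Weyl group both sides are \<open>undefined\<close> by
    restriction.\<close>
  then have "(C_op \<Phi> coroot \<alpha> \<circ> C_op \<Phi> coroot \<alpha>) f =
      (\<lambda>\<sigma>\<in>weyl_group \<Phi> coroot. kappa (coroot \<alpha>) * f \<sigma>)" for f
    by (auto simp: fun_eq_iff W_def C_op_def)
  moreover have "fps_nth (kappa (coroot \<alpha>)) m \<in> lambda_h_functions" for m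
  proof -
    interpret field_relation "\<lambda>y z :: 'n ratfun. y = z \<and> y \<in> lambda_h_functions"
      by (rule field_relation_lambda_h)
    have in_S: "h \<in> lambda_h_functions" "\<nu> \<in> lambda_h_functions"
      by (simp_all add: h_def coord_h_def \<nu>_def nu_def character_lambda_h)
    \<comment> \<open>A series related to itself has all its coefficients in the subfield.\<close>
    have "fps_R (delta h \<nu> * delta h (inverse \<nu>)) (delta h \<nu> * delta h (inverse \<nu>))"
      using in_S h \<nu> R_inverse[of \<nu> \<nu>]
      by (intro fps_R_mult fps_R_delta) (simp_all add: inverse_eq_1_iff)
    then show ?thesis
      by (simp add: fps_R_def kappa_def h_def \<nu>_def inverse_eq_divide)
  qed
  ultimately show ?thesis by blast
qed

end
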